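(* Every pseudo-umbilical biharmonic submanifold of dimension four in the Euclidean space $\mathbb{E}^6$ is minimal.
   Context: A submanifold $M^m$ of a Riemannian manifold means an $m$-dimensional smooth manifold with an isometric immersion. $B$ is the second fundamental form, $A_\xi$ the Weingarten (shape) operator in the normal direction $\xi$, $\nabla^\perp$ the normal connection, $\mathbf{H}=\frac1m\sum_{i=1}^m B(e_i,e_i)$ the mean curvature vector field for a local orthonormal frame $\{e_i\}$, and $\Delta^\perp=\sum_i\big(\nabla^\perp_{e_i}\nabla^\perp_{e_i}-\nabla^\perp_{\nabla_{e_i}e_i}\big)$ the (non-positive) normal Laplacian. $M$ is minimal if $\mathbf{H}\equiv 0$. $M$ is pseudo-umbilical if $A_{\mathbf{H}}=|\mathbf{H}|^2\,\mathrm{Id}$ everywhere on $M$ ($\mathbf{H}$ may vanish). A submanifold of $\mathbb{E}^n$ is biharmonic if its mean curvature vector is harmonic, $\Delta\mathbf{H}=0$ ($\Delta$ the Laplacian of $M$ acting componentwise on $\mathbb{E}^n$-valued functions); equivalently, both $$\Delta^\perp\mathbf{H}-\sum_{i=1}^mB(A_{\mathbf{H}}e_i,e_i)=0,\qquad m\,\nabla|\mathbf{H}|^2+4\sum_{i=1}^mA_{\nabla^\perp_{e_i}\mathbf{H}}e_i=0$$ hold, where $\nabla|\mathbf H|^2$ is the gradient on $M$. *)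

theory Defs
  imports "HOL-Analysis.Analysis"
begin

section \<open>Smooth maps and smooth manifolds\<close>

definition dir_deriv ::
    "'a::real_normed_vector \<Rightarrow> ('a \<Rightarrow> 'b::real_normed_vector) \<Rightarrow> 'a \<Rightarrow> 'b"
  where "dir_deriv v f u = frechet_derivative f (at u) v"

text \<open>For open \<open>S\<close> in a finite-dimensional space this is membership in $C^k(S)$.\<close>

primrec Ck_on ::
    "nat \<Rightarrow> 'a::real_normed_vector set \<Rightarrow> ('a \<Rightarrow> 'b::real_normed_vector) \<Rightarrow> bool"
  where
    "Ck_on 0 S f \<longleftrightarrow> continuous_on S f"
  | "Ck_on (Suc k) S f \<longleftrightarrow>
       (\<forall>u\<in>S. f differentiable (at u)) \<and> (\<forall>v. Ck_on k S (dir_deriv v f))"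

definition smooth_on ::
    "'a::real_normed_vector set \<Rightarrow> ('a \<Rightarrow> 'b::real_normed_vector) \<Rightarrow> bool"
  where "smooth_on S f \<longleftrightarrow> (\<forall>k. Ck_on k S f)"

text \<open>A chart is a pair \<open>(U, \<phi>)\<close>; only the values of \<open>\<phi>\<close> on \<open>U\<close> matter.
  An atlas need not be maximal. The dimension of the manifold is \<open>CARD('m)\<close>.\<close>

type_synonym ('a, 'm) chart = "'a set \<times> ('a \<Rightarrow> real^'m)"

definition smooth_atlas :: "'a topology \<Rightarrow> ('a, 'm::finite) chart set \<Rightarrow> bool"
  where "smooth_atlas X \<A> \<longleftrightarrow>
    (\<Union>(U, \<phi>)\<in>\<A>. U) = topspace X \<and>
    (\<forall>(U, \<phi>)\<in>\<A>. openin X U \<and> open (\<phi> ` U) \<and>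
       homeomorphic_map (subtopology X U) (top_of_set (\<phi> ` U)) \<phi>) \<and>
    (\<forall>(U, \<phi>)\<in>\<A>. \<forall>(V, \<psi>)\<in>\<A>. smooth_on (\<phi> ` (U \<inter> V)) (\<psi> \<circ> inv_into U \<phi>))"

definition smooth_manifold :: "'a topology \<Rightarrow> ('a, 'm::finite) chart set \<Rightarrow> bool"
  where "smooth_manifold X \<A> \<longleftrightarrow>
    Hausdorff_space X \<and> second_countable X \<and> smooth_atlas X \<A>"

definition local_rep :: "('a \<Rightarrow> 'b) \<Rightarrow> ('a, 'm::finite) chart \<Rightarrow> real^'m \<Rightarrow> 'b"
  where "local_rep f c = f \<circ> inv_into (fst c) (snd c)"

abbreviation chart_image :: "('a, 'm::finite) chart \<Rightarrow> (real^'m) set"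
  where "chart_image c \<equiv> snd c ` fst c"

definition smooth_immersion ::
    "('a, 'm::finite) chart set \<Rightarrow> ('a \<Rightarrow> 'b::euclidean_space) \<Rightarrow> bool"
  where "smooth_immersion \<A> f \<longleftrightarrow>
    (\<forall>c\<in>\<A>. smooth_on (chart_image c) (local_rep f c) \<and>
       (\<forall>u\<in>chart_image c. inj (frechet_derivative (local_rep f c) (at u))))"

text \<open>The Riemannian metric of a submanifold is the one induced by the immersion, so that the
  immersion is isometric.\<close>

definition immersed_submanifold ::
    "'a topology \<Rightarrow> ('a, 'm::finite) chart set \<Rightarrow> ('a \<Rightarrow> 'b::euclidean_space) \<Rightarrow> bool"
  where "immersed_submanifold X \<A> f \<longleftrightarrow> smooth_manifold X \<A> \<and> smooth_immersion \<A> f"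


section \<open>Geometry of a local parametrization\<close>

text \<open>In this section \<open>x\<close> is an immersion of an open set of \<open>real^'m\<close> into Euclidean space, in
  the applications the local representation of an immersion of a manifold. Tangent vectors of
  the submanifold at \<open>x u\<close> are given by their coordinates, i.e. \<open>v\<close> stands for
  \<open>dir_deriv v x u\<close>.\<close>

definition partial ::
    "'m \<Rightarrow> (real^'m \<Rightarrow> 'b::real_normed_vector) \<Rightarrow> real^'m::finite \<Rightarrow> 'b"
  where "partial i h u = dir_deriv (axis i 1) h u"

definition induced_metric :: "(real^'m \<Rightarrow> 'b::euclidean_space) \<Rightarrow> real^'m::finite \<Rightarrow> real^'m^'m"
  where "induced_metric x u = (\<chi> i j. partial i x u \<bullet> partial j x u)"

definition metric_inv :: "(real^'m \<Rightarrow> 'b::euclidean_space) \<Rightarrow> real^'m::finite \<Rightarrow> real^'m^'m"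
  where "metric_inv x u = matrix_inv (induced_metric x u)"

text \<open>The trace with respect to the induced metric; by \<open>metric_trace_orthonormal\<close> below it is
  $\sum_i T(e_i, e_i)$ for every orthonormal basis $(e_i)$ of the tangent space.\<close>

definition metric_trace ::
    "(real^'m \<Rightarrow> 'b::euclidean_space) \<Rightarrow> real^'m::finite
      \<Rightarrow> (real^'m \<Rightarrow> real^'m \<Rightarrow> 'c::real_vector) \<Rightarrow> 'c"
  where "metric_trace x u T =
    (\<Sum>i\<in>UNIV. \<Sum>j\<in>UNIV. (metric_inv x u $ i $ j) *\<^sub>R T (axis i 1) (axis j 1))"

text \<open>Orthogonal projection of an ambient vector to the normal space at \<open>x u\<close>; the term
  subtracted is its tangential part.\<close>

definition normal_part ::
    "(real^'m \<Rightarrow> 'b::euclidean_space) \<Rightarrow> real^'m::finite \<Rightarrow> 'b \<Rightarrow> 'b"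
  where "normal_part x u y =
    y - dir_deriv (metric_inv x u *v (\<chi> j. y \<bullet> partial j x u)) x u"

text \<open>Gauss formula $B(V,W) = (D_V W)^\perp$, with $V$, $W$ extended to vector fields having
  constant coefficients in the coordinate frame.\<close>

definition second_fundamental_form ::
    "(real^'m \<Rightarrow> 'b::euclidean_space) \<Rightarrow> real^'m::finite \<Rightarrow> real^'m \<Rightarrow> real^'m \<Rightarrow> 'b"
  where "second_fundamental_form x u v w =
    normal_part x u (dir_deriv v (dir_deriv w x) u)"

definition mean_curvature ::
    "(real^'m \<Rightarrow> 'b::euclidean_space) \<Rightarrow> real^'m::finite \<Rightarrow> 'b"
  where "mean_curvature x u =
    (1 / real CARD('m)) *\<^sub>R metric_trace x u (second_fundamental_form x u)"

text \<open>$A_\xi v$ is determined by $g(A_\xi v, w) = \langle B(v,w), \xi\rangle$.\<close>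

definition shape_operator ::
    "(real^'m \<Rightarrow> 'b::euclidean_space) \<Rightarrow> real^'m::finite \<Rightarrow> 'b \<Rightarrow> real^'m \<Rightarrow> real^'m"
  where "shape_operator x u \<xi> v =
    metric_inv x u *v (\<chi> j. second_fundamental_form x u v (axis j 1) \<bullet> \<xi>)"

text \<open>$\Gamma^k_{ij}$ of the Levi-Civita connection of the induced metric.\<close>

definition christoffel ::
    "(real^'m \<Rightarrow> 'b::euclidean_space) \<Rightarrow> real^'m::finite \<Rightarrow> 'm \<Rightarrow> 'm \<Rightarrow> 'm \<Rightarrow> real"
  where "christoffel x u k i j =
    (1 / 2) * (\<Sum>l\<in>UNIV. metric_inv x u $ k $ l *
       (partial i (\<lambda>v. induced_metric x v $ j $ l) u + partial j (\<lambda>v. induced_metric x v $ i $ l) u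
         - partial l (\<lambda>v. induced_metric x v $ i $ j) u))"

text \<open>The Laplacian $\sum_i (e_i e_i - \nabla_{e_i} e_i)$, i.e. the trace of the Hessian
  $\partial_i\partial_j h - \sum_k \Gamma^k_{ij}\,\partial_k h$. On a vector-valued \<open>h\<close> it acts
  componentwise.\<close>

definition laplacian ::
    "(real^'m \<Rightarrow> 'b::euclidean_space) \<Rightarrow> (real^'m \<Rightarrow> 'c::real_normed_vector)
      \<Rightarrow> real^'m::finite \<Rightarrow> 'c"
  where "laplacian x h u =
    (\<Sum>i\<in>UNIV. \<Sum>j\<in>UNIV. (metric_inv x u $ i $ j) *\<^sub>R
       (partial i (partial j h) u - (\<Sum>k\<in>UNIV. christoffel x u k i j *\<^sub>R partial k h u)))"


section \<open>Classes of submanifolds\<close>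

text \<open>The conditions below are independent of coordinates and are required at every point in
  every chart of the atlas.\<close>

definition minimal_submanifold ::
    "('a, 'm::finite) chart set \<Rightarrow> ('a \<Rightarrow> 'b::euclidean_space) \<Rightarrow> bool"
  where "minimal_submanifold \<A> f \<longleftrightarrow>
    (\<forall>c\<in>\<A>. \<forall>u\<in>chart_image c. mean_curvature (local_rep f c) u = 0)"

definition pseudo_umbilical ::
    "('a, 'm::finite) chart set \<Rightarrow> ('a \<Rightarrow> 'b::euclidean_space) \<Rightarrow> bool"
  where "pseudo_umbilical \<A> f \<longleftrightarrow>
    (\<forall>c\<in>\<A>. \<forall>u\<in>chart_image c. \<forall>v.
       shape_operator (local_rep f c) u (mean_curvature (local_rep f c) u) v
         = (norm (mean_curvature (local_rep f c) u))\<^sup>2 *\<^sub>R v)"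

definition biharmonic_submanifold ::
    "('a, 'm::finite) chart set \<Rightarrow> ('a \<Rightarrow> 'b::euclidean_space) \<Rightarrow> bool"
  where "biharmonic_submanifold \<A> f \<longleftrightarrow>
    (\<forall>c\<in>\<A>. \<forall>u\<in>chart_image c.
       laplacian (local_rep f c) (mean_curvature (local_rep f c)) u = 0)"


section \<open>The coordinate formulas agree with the invariant descriptions\<close>

lemma linear_dir_deriv: "f differentiable (at u) \<Longrightarrow> linear (\<lambda>v. dir_deriv v f u)"
  unfolding dir_deriv_def by (rule linear_frechet_derivative)

lemma dir_deriv_eq_sum_partial:
  fixes x :: "real^'m::finite \<Rightarrow> 'b::real_normed_vector"
  assumes "x differentiable (at u)"
  shows "dir_deriv v x u = (\<Sum>i\<in>UNIV. v $ i *\<^sub>R partial i x u)"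
proof -
  have "dir_deriv v x u = dir_deriv (\<Sum>i\<in>UNIV. v $ i *\<^sub>R axis i 1) x u"
    by (simp add: basis_expansion flip: scalar_mult_eq_scaleR)
  also have "\<dots> = (\<Sum>i\<in>UNIV. v $ i *\<^sub>R partial i x u)"
    using linear_dir_deriv[OF assms, THEN linear_sum, of "\<lambda>i. v $ i *\<^sub>R axis i 1" UNIV]
      linear_dir_deriv[OF assms, THEN linear_cmul]
    by (simp add: partial_def)
  finally show ?thesis .
qed

lemma inner_induced_metric:
  assumes "x differentiable (at u)"
  shows "v \<bullet> (induced_metric x u *v w) = dir_deriv v x u \<bullet> dir_deriv w x u"
  unfolding dir_deriv_eq_sum_partial[OF assms] induced_metric_def
  by (simp add: inner_vec_def matrix_vector_mult_def inner_sum_left inner_sum_right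
      sum_distrib_left mult_ac) (rule sum.swap)

lemma metric_inv:
  assumes "x differentiable (at u)" "inj (frechet_derivative x (at u))"
  shows "induced_metric x u ** metric_inv x u = mat 1" "metric_inv x u ** induced_metric x u = mat 1"
proof -
  have "v = 0" if "induced_metric x u *v v = 0" for v
  proof -
    have "dir_deriv v x u = 0"
      using inner_induced_metric[OF assms(1), of v v] that by simp
    then show ?thesis
      using assms linear_injective_0[OF linear_frechet_derivative[OF assms(1)]]
      by (simp add: dir_deriv_def)
  qed
  then obtain C where "C ** induced_metric x u = mat 1"
    using matrix_left_invertible_ker by blast
  then have "invertible (induced_metric x u)"
    by (metis invertible_def matrix_left_right_inverse)
  then show "induced_metric x u ** metric_inv x u = mat 1" "metric_inv x u ** induced_metric x u = mat 1"
    unfolding metric_inv_def matrix_inv_def invertible_def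
    by (metis (mono_tags, lifting) someI_ex)+
qed

lemma normal_part_orthogonal:
  assumes "x differentiable (at u)" "inj (frechet_derivative x (at u))"
  shows "normal_part x u y \<bullet> dir_deriv v x u = 0"
proof -
  let ?z = "\<chi> j. y \<bullet> partial j x u"
  have "dir_deriv v x u \<bullet> dir_deriv (metric_inv x u *v ?z) x u = v \<bullet> ?z"
    by (simp add: inner_induced_metric[OF assms(1), symmetric] matrix_vector_mul_assoc
        metric_inv[OF assms])
  also have "\<dots> = dir_deriv v x u \<bullet> y"
    by (simp add: dir_deriv_eq_sum_partial[OF assms(1)] inner_vec_def inner_sum_right
        inner_commute[of _ y])
  finally show ?thesis
    by (simp add: normal_part_def inner_diff_right inner_commute[of "normal_part x u y"]
        inner_commute[of _ "dir_deriv v x u"])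
qed

lemma metric_trace_orthonormal:
  fixes x :: "real^'m::finite \<Rightarrow> 'b::euclidean_space" and T :: "real^'m \<Rightarrow> real^'m \<Rightarrow> 'c::real_vector"
  assumes x: "x differentiable (at u)" "inj (frechet_derivative x (at u))"
    and T: "bilinear T"
    and e: "\<And>a b. dir_deriv (e a) x u \<bullet> dir_deriv (e b) x u = (if a = b then 1 else 0)"
  shows "metric_trace x u T = (\<Sum>a::'m\<in>UNIV. T (e a) (e a))"
proof -
  define E :: "real^'m^'m" where "E = (\<chi> i a. e a $ i)"
  have "(transpose E ** (induced_metric x u ** E)) $ a $ b = (mat 1 :: real^'m^'m) $ a $ b" for a b
  proof -
    have "(transpose E ** (induced_metric x u ** E)) $ a $ b = e a \<bullet> (induced_metric x u *v e b)"
      by (simp add: E_def matrix_matrix_mult_def transpose_def inner_vec_def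
          matrix_vector_mult_def)
    then show ?thesis
      using e[of a b] by (simp add: inner_induced_metric[OF x(1)] mat_def)
  qed
  then have "transpose E ** (induced_metric x u ** E) = mat 1"
    by (simp add: vec_eq_iff)
  then have "E ** (transpose E ** induced_metric x u) = mat 1"
    by (metis matrix_left_right_inverse matrix_mul_assoc)
  then have "E ** transpose E = metric_inv x u"
    by (metis matrix_mul_assoc matrix_mul_lid matrix_mul_rid metric_inv(1)[OF x])
  then have inv: "metric_inv x u $ i $ j = (\<Sum>a\<in>UNIV. e a $ i * e a $ j)" for i j
    by (auto simp: E_def matrix_matrix_mult_def transpose_def vec_eq_iff)
  have expand: "T (e a) (e a)
      = (\<Sum>i\<in>UNIV. \<Sum>j\<in>UNIV. (e a $ i * e a $ j) *\<^sub>R T (axis i 1) (axis j 1))" for a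
  proof -
    have "T (e a) (e a) = T (\<Sum>i\<in>UNIV. e a $ i *\<^sub>R axis i 1) (\<Sum>j\<in>UNIV. e a $ j *\<^sub>R axis j 1)"
      by (simp add: basis_expansion flip: scalar_mult_eq_scaleR)
    also have "\<dots> = (\<Sum>i\<in>UNIV. \<Sum>j\<in>UNIV. (e a $ i * e a $ j) *\<^sub>R T (axis i 1) (axis j 1))"
      by (simp add: bilinear_sum[OF T] bilinear_lmul[OF T] bilinear_rmul[OF T] mult.commute
          sum.cartesian_product)
    finally show ?thesis .
  qed
  have "metric_trace x u T
      = (\<Sum>i\<in>UNIV. \<Sum>j\<in>UNIV. \<Sum>a\<in>UNIV. (e a $ i * e a $ j) *\<^sub>R T (axis i 1) (axis j 1))"
    by (simp add: metric_trace_def inv scaleR_sum_left)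
  also have "\<dots> = (\<Sum>i\<in>UNIV. \<Sum>a\<in>UNIV. \<Sum>j\<in>UNIV. (e a $ i * e a $ j) *\<^sub>R T (axis i 1) (axis j 1))"
    by (intro sum.cong refl sum.swap)
  also have "\<dots> = (\<Sum>a\<in>UNIV. \<Sum>i\<in>UNIV. \<Sum>j\<in>UNIV. (e a $ i * e a $ j) *\<^sub>R T (axis i 1) (axis j 1))"
    by (rule sum.swap)
  finally show ?thesis by (simp add: expand)
qed

lemma bilinear_second_fundamental_form:
  fixes x :: "real^'m::finite \<Rightarrow> 'b::euclidean_space"
  assumes S: "open S" "u \<in> S" and x: "smooth_on S x"
  shows "bilinear (second_fundamental_form x u)"
proof -
  have d1: "x differentiable (at v)" if "v \<in> S" for v
    using x that by (auto simp: smooth_on_def dest: spec[of _ "Suc 0"])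
  have d2: "dir_deriv w x differentiable (at u)" for w
    using x S(2) by (auto simp: smooth_on_def dest: spec[of _ "Suc (Suc 0)"])
  have "linear (\<lambda>y. \<chi> j. y \<bullet> partial j x u)"
    by (rule linearI) (simp_all add: vec_eq_iff inner_add_left)
  then have "linear (\<lambda>y. metric_inv x u *v (\<chi> j. y \<bullet> partial j x u))"
    using linear_compose[OF _ matrix_vector_mul_linear] by (simp add: o_def)
  then have "linear (\<lambda>y. dir_deriv (metric_inv x u *v (\<chi> j. y \<bullet> partial j x u)) x u)"
    using linear_compose[OF _ linear_dir_deriv[OF d1[OF S(2)]]] by (simp add: o_def)
  then have "linear (normal_part x u)"
    unfolding normal_part_def by (rule linear_compose_sub[OF linear_ident])
  have D: "dir_deriv v h u = dir_deriv v k u"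
    if "(k has_derivative k') (at u)" "\<And>z. z \<in> S \<Longrightarrow> h z = k z" for v k' and h k :: "real^'m \<Rightarrow> 'b"
  proof -
    have "(h has_derivative k') (at u)"
      by (rule has_derivative_transform_within_open[OF that(1) S]) (simp add: that(2))
    then show ?thesis
      using frechet_derivative_at[OF that(1)] frechet_derivative_at[of h k' u]
      by (simp add: dir_deriv_def)
  qed
  have D2: "(dir_deriv w x has_derivative (\<lambda>v. dir_deriv v (dir_deriv w x) u)) (at u)" for w
    using d2[of w] unfolding frechet_derivative_works by (simp add: dir_deriv_def[of _ "dir_deriv w x"])
  have add: "dir_deriv v (dir_deriv (w + z) x) u
      = dir_deriv v (dir_deriv w x) u + dir_deriv v (dir_deriv z x) u" for v w z
  proof -
    have A: "((\<lambda>y. dir_deriv w x y + dir_deriv z x y) has_derivative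
        (\<lambda>v. dir_deriv v (dir_deriv w x) u + dir_deriv v (dir_deriv z x) u)) (at u)"
      by (intro has_derivative_add D2)
    have "dir_deriv v (dir_deriv (w + z) x) u = dir_deriv v (\<lambda>y. dir_deriv w x y + dir_deriv z x y) u"
      by (rule D[OF A]) (simp add: linear_add[OF linear_dir_deriv[OF d1]])
    then show ?thesis
      using fun_cong[OF frechet_derivative_at[OF A], of v]
      by (simp add: dir_deriv_def[of v "\<lambda>y. dir_deriv w x y + dir_deriv z x y"])
  qed
  have scale: "dir_deriv v (dir_deriv (c *\<^sub>R w) x) u = c *\<^sub>R dir_deriv v (dir_deriv w x) u" for v w c
  proof -
    have A: "((\<lambda>y. c *\<^sub>R dir_deriv w x y) has_derivative
        (\<lambda>v. c *\<^sub>R dir_deriv v (dir_deriv w x) u)) (at u)"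
      by (intro has_derivative_scaleR_right D2)
    have "dir_deriv v (dir_deriv (c *\<^sub>R w) x) u = dir_deriv v (\<lambda>y. c *\<^sub>R dir_deriv w x y) u"
      by (rule D[OF A]) (simp add: linear_cmul[OF linear_dir_deriv[OF d1]])
    then show ?thesis
      using fun_cong[OF frechet_derivative_at[OF A], of v]
      by (simp add: dir_deriv_def[of v "\<lambda>y. c *\<^sub>R dir_deriv w x y"])
  qed
  show ?thesis
    unfolding bilinear_def second_fundamental_form_def
    using linear_add[OF \<open>linear (normal_part x u)\<close>] linear_cmul[OF \<open>linear (normal_part x u)\<close>]
      linear_add[OF linear_dir_deriv[OF d2]] linear_cmul[OF linear_dir_deriv[OF d2]]
    by (auto intro!: linearI simp: add scale)
qed

lemma mean_curvature_orthonormal: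
  fixes x :: "real^'m::finite \<Rightarrow> 'b::euclidean_space"
  assumes "open S" "u \<in> S" "smooth_on S x" "inj (frechet_derivative x (at u))"
    and "\<And>a b. dir_deriv (e a) x u \<bullet> dir_deriv (e b) x u = (if a = b then 1 else 0)"
  shows "mean_curvature x u
    = (1 / real CARD('m)) *\<^sub>R (\<Sum>a::'m\<in>UNIV. second_fundamental_form x u (e a) (e a))"
proof -
  have "x differentiable (at u)"
    using assms(2,3) by (auto simp: smooth_on_def dest: spec[of _ "Suc 0"])
  then show ?thesis
    unfolding mean_curvature_def
    by (subst metric_trace_orthonormal[where e = e])
      (use assms bilinear_second_fundamental_form[OF assms(1-3)] in auto)
qed

lemma shape_operator:
  fixes x :: "real^'m::finite \<Rightarrow> 'b::euclidean_space"
  assumes "open S" "u \<in> S" "smooth_on S x" "inj (frechet_derivative x (at u))"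
  shows "dir_deriv (shape_operator x u \<xi> v) x u \<bullet> dir_deriv w x u
    = second_fundamental_form x u v w \<bullet> \<xi>"
proof -
  let ?B = "second_fundamental_form x u"
  have d: "x differentiable (at u)"
    using assms(2,3) by (auto simp: smooth_on_def dest: spec[of _ "Suc 0"])
  have lin: "linear (?B v)"
    using bilinear_second_fundamental_form[OF assms(1-3)] by (simp add: bilinear_def)
  have "dir_deriv w x u \<bullet> dir_deriv (shape_operator x u \<xi> v) x u
      = w \<bullet> (\<chi> j. ?B v (axis j 1) \<bullet> \<xi>)"
    by (simp add: inner_induced_metric[OF d, symmetric] shape_operator_def matrix_vector_mul_assoc
        metric_inv[OF d assms(4)])
  also have "\<dots> = ?B v (\<Sum>j\<in>UNIV. w $ j *\<^sub>R axis j 1) \<bullet> \<xi>"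
    by (simp add: linear_sum[OF lin] linear_cmul[OF lin] inner_sum_left inner_vec_def)
  finally show ?thesis
    by (simp add: basis_expansion inner_commute flip: scalar_mult_eq_scaleR)
qed

end

theory Submission
  imports Defs
begin

text \<open>
  Work where $Q = |H|^2$ is positive. If $dQ = 0$ on an open set, then $0 = \Delta Q / 2 = |DH|^2$,
  whereas the tangential part of $DH$ is $-Q\,dx$; this is impossible. Where $dQ \neq 0$, the Codazzi
  equation and codimension two give $DH = -Q\,dx + dQ \otimes J$ with $J$ normal. Symmetry of second
  derivatives then yields $DJ = -dx + dQ \otimes M$, $DM = dQ \otimes M_1$, and, for
  $N = \nabla Q$, $DN = n\,dx + dQ \otimes N_1$. Consequently $Q$, $r = |J|^2$ and
  $P = |\nabla Q|^2$ depend on a single parameter. In terms of it, $\Delta H = 0$ gives $dr/dQ$, the trace of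
  the Hessian of $Q$ gives $dP/dQ$, and the symmetry of $D^2 N$ (the Gauss equation) gives a polynomial relation
  between $Q r$ and $Q^3/P$. This relation and its derivative contradict each other when
  $4 Q r > 1$, a strict Cauchy-Schwarz inequality coming from $\langle H, J\rangle = 1/2$.
\<close>

section \<open>Calculus of smooth maps\<close>

text \<open>Neither a unit normal frame nor the normal connection is handled: all statements are
  about ambient derivatives and inner products, with the tangent vectors \<open>X v\<close>,
  \<open>H\<close> and \<open>J\<close> spanning the ambient space. \<open>J\<close> is preferred to
  a unit normal because the symmetry of second derivatives passes from \<open>H\<close> on to it
  directly. Dependence on a single parameter is never realized by writing something as a function of
  \<open>Q\<close>; it means that the derivative vanishes on the kernel of \<open>dQ\<close>, so no
  curve is integrated and every identity is read off at a point. Each step produces one unknown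
  vector, and codimension two makes it computable: \<open>M\<close> from biharmonicity,
  \<open>N1\<close> from its inner products with the spanning vectors. Differentiating the resulting
  formula for \<open>N1\<close> along the kernel of \<open>dQ\<close> must agree with what the
  symmetry of second derivatives says about \<open>N1\<close>, and this comparison is the source of
  the polynomial relation.\<close>

lemma dir_deriv_eq: "(f has_derivative f') (at u) \<Longrightarrow> dir_deriv v f u = f' v"
  by (simp add: dir_deriv_def flip: frechet_derivative_at)

lemma has_derivative_dir_deriv:
  "f differentiable (at u) \<Longrightarrow> (f has_derivative (\<lambda>v. dir_deriv v f u)) (at u)"
  by (simp add: dir_deriv_def frechet_derivative_works)

lemma dir_deriv_const: "dir_deriv v (\<lambda>p. c) u = 0"
  by (rule dir_deriv_eq[OF has_derivative_const])

lemma dir_deriv_add: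
  "f differentiable (at u) \<Longrightarrow> g differentiable (at u) \<Longrightarrow>
    dir_deriv v (\<lambda>p. f p + g p) u = dir_deriv v f u + dir_deriv v g u"
  by (rule dir_deriv_eq[OF has_derivative_add[OF has_derivative_dir_deriv has_derivative_dir_deriv]])

lemma dir_deriv_diff:
  "f differentiable (at u) \<Longrightarrow> g differentiable (at u) \<Longrightarrow>
    dir_deriv v (\<lambda>p. f p - g p) u = dir_deriv v f u - dir_deriv v g u"
  by (rule dir_deriv_eq[OF has_derivative_diff[OF has_derivative_dir_deriv has_derivative_dir_deriv]])

lemma dir_deriv_minus:
  "f differentiable (at u) \<Longrightarrow> dir_deriv v (\<lambda>p. - f p) u = - dir_deriv v f u"
  by (rule dir_deriv_eq[OF has_derivative_minus[OF has_derivative_dir_deriv]])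

lemma dir_deriv_scaleR:
  "f differentiable (at u) \<Longrightarrow> g differentiable (at u) \<Longrightarrow>
    dir_deriv v (\<lambda>p. f p *\<^sub>R g p) u = f u *\<^sub>R dir_deriv v g u + dir_deriv v f u *\<^sub>R g u"
  by (rule dir_deriv_eq[OF has_derivative_scaleR[OF has_derivative_dir_deriv has_derivative_dir_deriv]])

lemma dir_deriv_mult:
  fixes f g :: "_ \<Rightarrow> real"
  shows "f differentiable (at u) \<Longrightarrow> g differentiable (at u) \<Longrightarrow>
    dir_deriv v (\<lambda>p. f p * g p) u = f u * dir_deriv v g u + dir_deriv v f u * g u"
  by (rule dir_deriv_eq[OF has_derivative_mult[OF has_derivative_dir_deriv has_derivative_dir_deriv]])

lemma dir_deriv_power:
  fixes f :: "_ \<Rightarrow> real"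
  shows "f differentiable (at u) \<Longrightarrow>
    dir_deriv v (\<lambda>p. f p ^ k) u = real k * dir_deriv v f u * f u ^ (k - 1)"
  by (rule dir_deriv_eq[OF has_derivative_power[OF has_derivative_dir_deriv], THEN trans]) simp_all

lemmas dir_deriv_simps = dir_deriv_add dir_deriv_diff dir_deriv_minus dir_deriv_scaleR dir_deriv_mult
  dir_deriv_power dir_deriv_const differentiable_add differentiable_diff differentiable_minus
  differentiable_scaleR differentiable_mult differentiable_power differentiable_const

lemma dir_deriv_cong:
  assumes "open S" "u \<in> S" "\<And>z. z \<in> S \<Longrightarrow> f z = g z"
  shows "dir_deriv v f u = dir_deriv v g u"
proof -
  have "(f has_derivative D) (at u) \<longleftrightarrow> (g has_derivative D) (at u)" for D
    using has_derivative_transform_within_open[OF _ assms(1,2), of f D UNIV g]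
      has_derivative_transform_within_open[OF _ assms(1,2), of g D UNIV f] assms(3) by auto
  then show ?thesis by (simp add: dir_deriv_def frechet_derivative_def)
qed

text \<open>Formulas for derivatives hold only at points of \<open>S\<close>. Openness makes a
  derivative there depend on values in \<open>S\<close> alone, so the inductions on \<open>k\<close>
  below may replace a derivative by its formula.\<close>

lemma Ck_on_cong:
  assumes "open S"
  shows "Ck_on k S f \<Longrightarrow> (\<And>z. z \<in> S \<Longrightarrow> f z = g z) \<Longrightarrow> Ck_on k S g"
proof (induction k arbitrary: f g)
  case 0
  then show ?case using continuous_on_cong[of S S f g] by auto
next
  case (Suc k)
  have "g differentiable (at u)" if "u \<in> S" for u
    using Suc.prems that has_derivative_transform_within_open[OF _ assms that, of f _ UNIV g]
    by (auto simp: differentiable_def) blast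
  moreover have "Ck_on k S (dir_deriv v g)" for v
    using Suc.IH[of "dir_deriv v f"] Suc.prems dir_deriv_cong[OF assms, of _ f g] by auto
  ultimately show ?case by simp
qed

lemma Ck_on_SucD: "Ck_on (Suc k) S f \<Longrightarrow> Ck_on k S f"
proof (induction k arbitrary: f)
  case 0
  then show ?case
    by (auto simp: continuous_on_eq_continuous_within
        intro: differentiable_imp_continuous_within differentiable_at_withinI)
next
  case (Suc k)
  from Suc.prems have "\<forall>u\<in>S. f differentiable (at u)" "\<And>v. Ck_on (Suc k) S (dir_deriv v f)"
    unfolding Ck_on.simps(2)[of "Suc k"] by blast+
  with Suc.IH show ?case by simp
qed

lemma smooth_on_rec:
  "smooth_on S f \<longleftrightarrow> (\<forall>u\<in>S. f differentiable (at u)) \<and> (\<forall>v. smooth_on S (dir_deriv v f))"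
proof
  assume "smooth_on S f"
  then have "Ck_on (Suc k) S f" for k by (simp only: smooth_on_def)
  then show "(\<forall>u\<in>S. f differentiable (at u)) \<and> (\<forall>v. smooth_on S (dir_deriv v f))"
    by (simp add: smooth_on_def)
next
  assume *: "(\<forall>u\<in>S. f differentiable (at u)) \<and> (\<forall>v. smooth_on S (dir_deriv v f))"
  have "Ck_on (Suc k) S f" for k using * by (simp add: smooth_on_def)
  then show "smooth_on S f" by (simp add: smooth_on_def Ck_on_SucD)
qed

lemma smooth_on_differentiable: "smooth_on S f \<Longrightarrow> u \<in> S \<Longrightarrow> f differentiable (at u)"
  and smooth_on_dir_deriv: "smooth_on S f \<Longrightarrow> smooth_on S (dir_deriv v f)"
  by (auto dest: smooth_on_rec[THEN iffD1])

lemma linear_dir_deriv_on: "smooth_on S F \<Longrightarrow> u \<in> S \<Longrightarrow> linear (\<lambda>v. dir_deriv v F u)"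
  by (rule linear_dir_deriv[OF smooth_on_differentiable])

lemma smooth_on_has_derivative:
  "smooth_on S f \<Longrightarrow> u \<in> S \<Longrightarrow> (f has_derivative (\<lambda>v. dir_deriv v f u)) (at u)"
  by (simp add: has_derivative_dir_deriv smooth_on_differentiable)

lemma smooth_on_continuous_on: "smooth_on S f \<Longrightarrow> continuous_on S f"
  using Ck_on.simps(1) by (auto simp only: smooth_on_def)

lemma smooth_on_cong:
  "open S \<Longrightarrow> smooth_on S f \<Longrightarrow> (\<And>z. z \<in> S \<Longrightarrow> f z = g z) \<Longrightarrow> smooth_on S g"
  unfolding smooth_on_def using Ck_on_cong by blast

lemma smooth_on_subset: "smooth_on S f \<Longrightarrow> T \<subseteq> S \<Longrightarrow> smooth_on T f"
proof -
  have "Ck_on k S f \<Longrightarrow> T \<subseteq> S \<Longrightarrow> Ck_on k T f" for k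
    by (induction k arbitrary: f) (auto intro: continuous_on_subset)
  then show "smooth_on S f \<Longrightarrow> T \<subseteq> S \<Longrightarrow> smooth_on T f" by (auto simp: smooth_on_def)
qed

lemma smooth_on_const: "smooth_on S (\<lambda>u. c)"
proof -
  have "Ck_on k S (\<lambda>u::'a. c :: 'b)" for k and c :: 'b
  proof (induction k arbitrary: c)
    case (Suc k)
    have "dir_deriv v (\<lambda>u::'a. c) = (\<lambda>u. 0)" for v
      by (rule ext, rule dir_deriv_eq[OF has_derivative_const])
    then show ?case using Suc by simp
  qed auto
  then show ?thesis by (simp add: smooth_on_def)
qed

lemma Ck_on_add:
  assumes "open S"
  shows "Ck_on k S f \<Longrightarrow> Ck_on k S g \<Longrightarrow> Ck_on k S (\<lambda>u. f u + g u)"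
proof (induction k arbitrary: f g)
  case 0
  then show ?case by (simp add: continuous_on_add)
next
  case (Suc k)
  have "Ck_on k S (dir_deriv v (\<lambda>u. f u + g u))" for v
    by (rule Ck_on_cong[OF assms Suc.IH[of "dir_deriv v f" "dir_deriv v g"]])
      (use Suc.prems in \<open>auto intro!: dir_deriv_eq[symmetric] derivative_eq_intros has_derivative_dir_deriv\<close>)
  then show ?case using Suc.prems by (simp add: differentiable_add)
qed

lemma smooth_on_add:
  "open S \<Longrightarrow> smooth_on S f \<Longrightarrow> smooth_on S g \<Longrightarrow> smooth_on S (\<lambda>u. f u + g u)"
  by (simp add: smooth_on_def Ck_on_add)

text \<open>One Leibniz induction serves scalar multiples, products and inner products.
  \<open>Ck_on_SucD\<close> supplies the undifferentiated factor in each of the two terms.\<close>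

lemma (in bounded_bilinear) Ck_on:
  assumes "open S"
  shows "Ck_on k S f \<Longrightarrow> Ck_on k S g \<Longrightarrow> Ck_on k S (\<lambda>u. prod (f u) (g u))"
proof (induction k arbitrary: f g)
  case 0
  then show ?case by (simp add: continuous_on)
next
  case (Suc k)
  have D: "((\<lambda>u. prod (f u) (g u)) has_derivative
      (\<lambda>v. prod (f u) (dir_deriv v g u) + prod (dir_deriv v f u) (g u))) (at u)"
    if "u \<in> S" for u
    using Suc.prems that by (auto intro!: FDERIV has_derivative_dir_deriv)
  have "Ck_on k S (dir_deriv v (\<lambda>u. prod (f u) (g u)))" for v
    by (rule Ck_on_cong[OF assms Ck_on_add[OF assms
          Suc.IH[of f "dir_deriv v g"] Suc.IH[of "dir_deriv v f" g]]])
      (use Suc.prems Ck_on_SucD[OF Suc.prems(1)] Ck_on_SucD[OF Suc.prems(2)] in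
        \<open>auto intro!: dir_deriv_eq[OF D, symmetric]\<close>)
  then show ?case using D by (auto simp: differentiable_def)
qed

lemma (in bounded_bilinear) smooth_on:
  "open S \<Longrightarrow> smooth_on S f \<Longrightarrow> smooth_on S g \<Longrightarrow> smooth_on S (\<lambda>u. prod (f u) (g u))"
  by (simp add: smooth_on_def Ck_on)

lemmas smooth_on_scaleR = bounded_bilinear.smooth_on[OF bounded_bilinear_scaleR]
lemmas smooth_on_mult = bounded_bilinear.smooth_on[OF bounded_bilinear_mult]
lemmas smooth_on_inner = bounded_bilinear.smooth_on[OF bounded_bilinear_inner]

lemma smooth_on_sum:
  assumes "open S" "\<And>i. i \<in> I \<Longrightarrow> smooth_on S (f i)"
  shows "smooth_on S (\<lambda>u. \<Sum>i\<in>I. f i u)"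
  using assms(2) by (induction I rule: infinite_finite_induct)
    (auto intro!: smooth_on_const smooth_on_add assms(1))

lemma smooth_on_prod:
  fixes f :: "'i \<Rightarrow> 'a::real_normed_vector \<Rightarrow> 'b::{real_normed_algebra,comm_ring_1}"
  assumes "open S" "\<And>i. i \<in> I \<Longrightarrow> smooth_on S (f i)"
  shows "smooth_on S (\<lambda>u. \<Prod>i\<in>I. f i u)"
  using assms(2) by (induction I rule: infinite_finite_induct)
    (auto intro!: smooth_on_const smooth_on_mult assms(1))

lemma smooth_on_minus:
  assumes "open S" "smooth_on S f" shows "smooth_on S (\<lambda>u. - f u)"
  using smooth_on_scaleR[OF assms(1) smooth_on_const assms(2), of "-1"] by simp

lemma smooth_on_diff:
  "open S \<Longrightarrow> smooth_on S f \<Longrightarrow> smooth_on S g \<Longrightarrow> smooth_on S (\<lambda>u. f u - g u)"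
  using smooth_on_add[OF _ _ smooth_on_minus, of S f g] by simp

text \<open>The derivative is a product of a smooth function and two copies of the inverse itself,
  so the inverse gains one order of regularity at each step.\<close>

lemma smooth_on_inverse:
  fixes f :: "'a::real_normed_vector \<Rightarrow> real"
  assumes S: "open S" and f: "smooth_on S f" and nz: "\<And>u. u \<in> S \<Longrightarrow> f u \<noteq> 0"
  shows "smooth_on S (\<lambda>u. inverse (f u))"
proof -
  have D: "((\<lambda>u. inverse (f u)) has_derivative (\<lambda>v. - (inverse (f u) * dir_deriv v f u * inverse (f u)))) (at u)"
    if "u \<in> S" for u
    by (rule Deriv.has_derivative_inverse) (use nz that smooth_on_has_derivative[OF f] in auto)
  have "Ck_on k S (\<lambda>u. inverse (f u))" for k
  proof (induction k)
    case 0
    show ?case using nz by (simp add: continuous_on_inverse smooth_on_continuous_on[OF f])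
  next
    case (Suc k)
    have fk: "Ck_on k S (dir_deriv v f)" for v
      using smooth_on_dir_deriv[OF f] by (simp add: smooth_on_def)
    have *: "Ck_on k S (\<lambda>u. (-1) * (inverse (f u) * dir_deriv v f u * inverse (f u)))" for v
      using smooth_on_const[of S "-1 :: real"]
      by (intro bounded_bilinear.Ck_on[OF bounded_bilinear_mult] S fk Suc) (simp add: smooth_on_def)
    have "Ck_on k S (dir_deriv v (\<lambda>u. inverse (f u)))" for v
      by (rule Ck_on_cong[OF S *[of v]]) (simp add: dir_deriv_eq[OF D])
    then show ?case using D by (auto simp: differentiable_def)
  qed
  then show ?thesis by (simp add: smooth_on_def)
qed

lemma smooth_on_divide:
  fixes f g :: "'a::real_normed_vector \<Rightarrow> real"
  assumes "open S" "smooth_on S f" "smooth_on S g" "\<And>u. u \<in> S \<Longrightarrow> g u \<noteq> 0"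
  shows "smooth_on S (\<lambda>u. f u / g u)"
  using smooth_on_mult[OF assms(1,2) smooth_on_inverse[OF assms(1,3,4)]]
  by (simp add: divide_inverse)

lemma smooth_on_det:
  fixes A :: "'a::real_normed_vector \<Rightarrow> real^'n^'n"
  assumes "open S" "\<And>i j. smooth_on S (\<lambda>u. A u $ i $ j)"
  shows "smooth_on S (\<lambda>u. det (A u))"
  unfolding det_def
  by (intro smooth_on_sum smooth_on_mult smooth_on_prod smooth_on_const assms)

lemmas smooth_on_intros = smooth_on_const smooth_on_add smooth_on_diff smooth_on_minus
  smooth_on_scaleR smooth_on_mult smooth_on_inner smooth_on_sum smooth_on_dir_deriv

lemma dir_deriv_inner:
  assumes S: "open S" "u \<in> S" and F: "smooth_on S F" and G: "smooth_on S G"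
    and eq: "\<And>p. p \<in> S \<Longrightarrow> F p \<bullet> G p = k p"
  shows "dir_deriv v F u \<bullet> G u + F u \<bullet> dir_deriv v G u = dir_deriv v k u"
proof -
  have "dir_deriv v (\<lambda>p. F p \<bullet> G p) u = F u \<bullet> dir_deriv v G u + dir_deriv v F u \<bullet> G u"
    by (rule dir_deriv_eq)
      (auto intro!: has_derivative_inner smooth_on_has_derivative[OF F S(2)] smooth_on_has_derivative[OF G S(2)])
  then show ?thesis using dir_deriv_cong[OF S eq] by simp
qed

section \<open>Symmetry of second derivatives\<close>

lemma second_difference:
  fixes f :: "'a::real_normed_vector \<Rightarrow> real"
  assumes S: "\<And>a b. 0 \<le> a \<Longrightarrow> a \<le> s \<Longrightarrow> 0 \<le> b \<Longrightarrow> b \<le> s \<Longrightarrow> p + a *\<^sub>R u + b *\<^sub>R v \<in> S"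
    and f: "smooth_on S f" and "0 < s"
  obtains a b where "0 \<le> a" "a \<le> s" "0 \<le> b" "b \<le> s"
    "f (p + s *\<^sub>R u + s *\<^sub>R v) - f (p + s *\<^sub>R u) - f (p + s *\<^sub>R v) + f p
      = s\<^sup>2 * dir_deriv v (dir_deriv u f) (p + a *\<^sub>R u + b *\<^sub>R v)"
proof -
  have D: "((\<lambda>a. f (p + a *\<^sub>R u + b *\<^sub>R v)) has_real_derivative dir_deriv u f (p + a *\<^sub>R u + b *\<^sub>R v)) (at a)"
    if "0 \<le> a" "a \<le> s" "0 \<le> b" "b \<le> s" for a b
  proof -
    have "((\<lambda>a. p + a *\<^sub>R u + b *\<^sub>R v) has_derivative (\<lambda>h. h *\<^sub>R u)) (at a)"
      by (auto intro!: derivative_eq_intros)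
    from has_derivative_compose[OF this smooth_on_has_derivative[OF f S[OF that]]]
    show ?thesis
      using linear_cmul[OF linear_dir_deriv[OF smooth_on_differentiable[OF f S[OF that]]]]
      by (simp add: has_field_derivative_def mult.commute[of "dir_deriv u f _"] mult_commute_abs)
  qed
  have D2: "((\<lambda>b. dir_deriv u f (p + a *\<^sub>R u + b *\<^sub>R v)) has_real_derivative
      dir_deriv v (dir_deriv u f) (p + a *\<^sub>R u + b *\<^sub>R v)) (at b)"
    if "0 \<le> a" "a \<le> s" "0 \<le> b" "b \<le> s" for a b
  proof -
    have "((\<lambda>b. p + a *\<^sub>R u + b *\<^sub>R v) has_derivative (\<lambda>h. h *\<^sub>R v)) (at b)"
      by (auto intro!: derivative_eq_intros)
    from has_derivative_compose[OF this smooth_on_has_derivative[OF smooth_on_dir_deriv[OF f] S[OF that]]]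
    show ?thesis
      using linear_cmul[OF linear_dir_deriv[OF smooth_on_differentiable[OF smooth_on_dir_deriv[OF f] S[OF that]]]]
      by (simp add: has_field_derivative_def mult_commute_abs)
  qed
  \<comment> \<open>The mean value theorem is applied first in \<open>a\<close>, then in
    \<open>b\<close>. The term \<open>0 *\<^sub>R v\<close> is kept so that \<open>D\<close> matches
    at \<open>b = 0\<close>.\<close>
  define \<phi> where "\<phi> a = f (p + a *\<^sub>R u + s *\<^sub>R v) - f (p + a *\<^sub>R u + 0 *\<^sub>R v)" for a
  have "\<exists>a. 0 < a \<and> a < s \<and> \<phi> s - \<phi> 0 = (s - 0) * (dir_deriv u f (p + a *\<^sub>R u + s *\<^sub>R v) - dir_deriv u f (p + a *\<^sub>R u + 0 *\<^sub>R v))"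
    unfolding \<phi>_def by (rule MVT2[OF \<open>0 < s\<close>]) (use \<open>0 < s\<close> in \<open>auto intro!: DERIV_diff D simp del: scaleR_zero_left\<close>)
  then obtain a where a: "0 < a" "a < s"
    "\<phi> s - \<phi> 0 = s * (dir_deriv u f (p + a *\<^sub>R u + s *\<^sub>R v) - dir_deriv u f (p + a *\<^sub>R u + 0 *\<^sub>R v))"
    by auto
  have "\<exists>b. 0 < b \<and> b < s \<and> dir_deriv u f (p + a *\<^sub>R u + s *\<^sub>R v) - dir_deriv u f (p + a *\<^sub>R u + 0 *\<^sub>R v)
      = (s - 0) * dir_deriv v (dir_deriv u f) (p + a *\<^sub>R u + b *\<^sub>R v)"
    by (rule MVT2[OF \<open>0 < s\<close>]) (use a in \<open>auto intro!: D2\<close>)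
  then obtain b where b: "0 < b" "b < s"
    "dir_deriv u f (p + a *\<^sub>R u + s *\<^sub>R v) - dir_deriv u f (p + a *\<^sub>R u + 0 *\<^sub>R v)
      = s * dir_deriv v (dir_deriv u f) (p + a *\<^sub>R u + b *\<^sub>R v)"
    by auto
  show ?thesis
    by (rule that[of a b]) (use a b in \<open>auto simp: \<phi>_def power2_eq_square algebra_simps\<close>)
qed

text \<open>The second difference is symmetric in \<open>u\<close> and \<open>v\<close>, so the two
  mixed derivatives agree at suitable points arbitrarily close to \<open>p\<close>, and continuity
  carries this to \<open>p\<close>.\<close>

lemma dir_deriv_commute_real:
  fixes f :: "'a::real_normed_vector \<Rightarrow> real"
  assumes S: "open S" "p \<in> S" and f: "smooth_on S f"
  shows "dir_deriv v (dir_deriv u f) p = dir_deriv u (dir_deriv v f) p"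
proof (rule ccontr)
  assume ne: "\<not> ?thesis"
  define e where "e = dist (dir_deriv v (dir_deriv u f) p) (dir_deriv u (dir_deriv v f) p) / 2"
  have e: "0 < e" using ne by (simp add: e_def)
  have cont: "isCont (dir_deriv w (dir_deriv z f)) p" for w z
    using smooth_on_continuous_on[OF smooth_on_dir_deriv[OF smooth_on_dir_deriv[OF f]]] S
    by (simp add: continuous_on_eq_continuous_at)
  have "eventually (\<lambda>q. q \<in> S \<and> dist (dir_deriv v (dir_deriv u f) q) (dir_deriv v (dir_deriv u f) p) < e
      \<and> dist (dir_deriv u (dir_deriv v f) q) (dir_deriv u (dir_deriv v f) p) < e) (nhds p)"
    using cont[unfolded isCont_def, THEN tendsto_at_iff_tendsto_nhds[THEN iffD1], THEN tendstoD, OF e]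
      eventually_nhds_in_open[OF S] by (intro eventually_conj) auto
  then obtain d where d: "0 < d" "\<And>q. dist q p < d \<Longrightarrow> q \<in> S
      \<and> dist (dir_deriv v (dir_deriv u f) q) (dir_deriv v (dir_deriv u f) p) < e
      \<and> dist (dir_deriv u (dir_deriv v f) q) (dir_deriv u (dir_deriv v f) p) < e"
    unfolding eventually_nhds_metric by blast
  \<comment> \<open>The summand 1 keeps the denominator positive when \<open>u\<close> and
    \<open>v\<close> vanish, and the factor 2 puts the whole parallelogram inside the ball of radius
    \<open>d\<close>.\<close>
  define s where "s = d / (2 * (norm u + norm v + 1))"
  have s: "0 < s" using d(1) by (simp add: s_def add_nonneg_pos)
  have near: "dist (p + a *\<^sub>R w + b *\<^sub>R z) p < d"
    if "0 \<le> a" "a \<le> s" "0 \<le> b" "b \<le> s" "(w, z) \<in> {(u, v), (v, u)}" for a b w z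
  proof -
    have "dist (p + a *\<^sub>R w + b *\<^sub>R z) p \<le> a * norm w + b * norm z"
      using norm_triangle_ineq[of "a *\<^sub>R w" "b *\<^sub>R z"] that by (simp add: dist_norm algebra_simps)
    also have "\<dots> \<le> s * norm w + s * norm z"
      using that by (intro add_mono mult_right_mono) auto
    also have "\<dots> = s * (norm u + norm v)" using that by (auto simp: algebra_simps)
    also have "\<dots> < s * (2 * (norm u + norm v + 1))"
      using s add_nonneg_nonneg[OF norm_ge_zero[of u] norm_ge_zero[of v]]
      by (simp add: mult_less_cancel_left del: add_nonneg_nonneg)
    also have "\<dots> = d"
      using norm_ge_zero[of u] norm_ge_zero[of v] by (simp add: s_def add_nonneg_eq_0_iff)
    finally show ?thesis .
  qed
  obtain a b where ab: "0 \<le> a" "a \<le> s" "0 \<le> b" "b \<le> s"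
    "f (p + s *\<^sub>R u + s *\<^sub>R v) - f (p + s *\<^sub>R u) - f (p + s *\<^sub>R v) + f p
      = s\<^sup>2 * dir_deriv v (dir_deriv u f) (p + a *\<^sub>R u + b *\<^sub>R v)"
    using second_difference[OF _ f s, of p u v] near d(2) by (metis insertI1)
  obtain a' b' where ab': "0 \<le> a'" "a' \<le> s" "0 \<le> b'" "b' \<le> s"
    "f (p + s *\<^sub>R v + s *\<^sub>R u) - f (p + s *\<^sub>R v) - f (p + s *\<^sub>R u) + f p
      = s\<^sup>2 * dir_deriv u (dir_deriv v f) (p + a' *\<^sub>R v + b' *\<^sub>R u)"
    using second_difference[OF _ f s, of p v u] near d(2) by (metis insertI1 insertI2)
  have "s\<^sup>2 * dir_deriv v (dir_deriv u f) (p + a *\<^sub>R u + b *\<^sub>R v)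
      = s\<^sup>2 * dir_deriv u (dir_deriv v f) (p + a' *\<^sub>R v + b' *\<^sub>R u)"
    unfolding ab(5)[symmetric] ab'(5)[symmetric] by (simp add: algebra_simps)
  then have "dir_deriv v (dir_deriv u f) (p + a *\<^sub>R u + b *\<^sub>R v)
      = dir_deriv u (dir_deriv v f) (p + a' *\<^sub>R v + b' *\<^sub>R u)"
    using s by simp
  moreover have "dist (dir_deriv v (dir_deriv u f) (p + a *\<^sub>R u + b *\<^sub>R v)) (dir_deriv v (dir_deriv u f) p) < e"
    using d(2)[OF near[OF ab(1-4), of u v]] by simp
  moreover have "dist (dir_deriv u (dir_deriv v f) (p + a' *\<^sub>R v + b' *\<^sub>R u)) (dir_deriv u (dir_deriv v f) p) < e"
    using d(2)[OF near[OF ab'(1-4), of v u]] by simp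
  ultimately show False
    using dist_triangle3[of "dir_deriv v (dir_deriv u f) p" "dir_deriv u (dir_deriv v f) p"
        "dir_deriv v (dir_deriv u f) (p + a *\<^sub>R u + b *\<^sub>R v)"]
    by (simp add: e_def)
qed

lemma dir_deriv_commute:
  fixes f :: "'a::real_normed_vector \<Rightarrow> 'b::euclidean_space"
  assumes S: "open S" "p \<in> S" and f: "smooth_on S f"
  shows "dir_deriv v (dir_deriv u f) p = dir_deriv u (dir_deriv v f) p"
proof (rule euclidean_eqI)
  fix b :: 'b
  have 1: "dir_deriv w (\<lambda>q. h q \<bullet> b) q = dir_deriv w h q \<bullet> b"
    if "smooth_on S h" "q \<in> S" for w h and q :: 'a
    by (rule dir_deriv_eq) (rule has_derivative_inner_left[OF smooth_on_has_derivative[OF that]])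
  have 2: "dir_deriv w (dir_deriv z (\<lambda>q. f q \<bullet> b)) p = dir_deriv w (dir_deriv z f) p \<bullet> b" for w z
    using dir_deriv_cong[OF S, of "dir_deriv z (\<lambda>q. f q \<bullet> b)" "\<lambda>q. dir_deriv z f q \<bullet> b" w]
      1[OF f] 1[OF smooth_on_dir_deriv[OF f] S(2)] by simp
  show "dir_deriv v (dir_deriv u f) p \<bullet> b = dir_deriv u (dir_deriv v f) p \<bullet> b"
    using dir_deriv_commute_real[OF S smooth_on_inner[OF S(1) f smooth_on_const]] 2 by metis
qed

section \<open>Geometry of an immersed coordinate patch\<close>

text \<open>Supplies auxiliary tangent vectors in dimension four: one in the kernel of
  \<open>dQ\<close>, and one that is killed by a functional and orthogonal to a given
  vector.\<close>

lemma common_zero_of_linear_functionals: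
  fixes f g :: "'a::euclidean_space \<Rightarrow> real"
  assumes "linear f" "linear g" "2 < DIM('a)"
  obtains v where "v \<noteq> 0" "f v = 0" "g v = 0"
proof -
  let ?h = "\<lambda>v. (f v, g v)"
  have lin: "linear ?h"
    by (rule linearI) (simp_all add: linear_add linear_cmul assms)
  have "\<not> inj ?h"
  proof
    assume "inj ?h"
    then have "dim (range ?h) = DIM('a)" using dim_image_eq[OF lin, of UNIV] by (simp add: span_UNIV)
    moreover have "dim (range ?h) \<le> 2" using dim_subset_UNIV[of "range ?h"] by simp
    ultimately show False using assms(3) by simp
  qed
  then show ?thesis using that linear_injective_0[OF lin] by (auto simp: zero_prod_def)
qed

text \<open>The gradient is given as an ambient vector, not by its coordinates.\<close>

definition gradient ::
    "(real^'m \<Rightarrow> 'b::euclidean_space) \<Rightarrow> (real^'m \<Rightarrow> real) \<Rightarrow> real^'m::finite \<Rightarrow> 'b"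
  where "gradient x h u = metric_trace x u (\<lambda>v w. dir_deriv v h u *\<^sub>R dir_deriv w x u)"

section \<open>Algebra of the metric trace, and the geometry of one chart\<close>

lemma partial_eq_dir_deriv: "partial i h = dir_deriv (axis i 1) h"
  by (rule ext) (simp add: partial_def)

lemma metric_trace_cong:
  "(\<And>i j. T (axis i 1) (axis j 1) = T' (axis i 1) (axis j 1)) \<Longrightarrow> metric_trace x u T = metric_trace x u T'"
  by (simp add: metric_trace_def)

lemma metric_trace_add:
  "metric_trace x u (\<lambda>v w. T v w + T' v w) = metric_trace x u T + metric_trace x u T'"
  by (simp add: metric_trace_def scaleR_add_right sum.distrib)

lemma metric_trace_diff:
  "metric_trace x u (\<lambda>v w. T v w - T' v w) = metric_trace x u T - metric_trace x u T'"
  by (simp add: metric_trace_def scaleR_diff_right sum_subtractf)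

lemma metric_trace_scaleR:
  "metric_trace x u (\<lambda>v w. c *\<^sub>R T v w) = c *\<^sub>R metric_trace x u T"
  by (simp add: metric_trace_def scaleR_sum_right mult.commute)

lemma metric_trace_scaleR_left:
  "metric_trace x u (\<lambda>v w. t v w *\<^sub>R y) = metric_trace x u t *\<^sub>R y"
  by (simp add: metric_trace_def scaleR_sum_left)

lemma metric_trace_inner_left:
  "metric_trace x u (\<lambda>v w. T v w \<bullet> y) = metric_trace x u T \<bullet> y"
  by (simp add: metric_trace_def inner_sum_left)

lemma metric_trace_sum:
  "metric_trace x u (\<lambda>v w. \<Sum>b\<in>A. T b v w) = (\<Sum>b\<in>A. metric_trace x u (T b))"
  by (induction A rule: infinite_finite_induct)
    (simp_all add: metric_trace_add, simp_all add: metric_trace_def)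

text \<open>Minimality is tested pointwise in each chart, so a single chart suffices. The set
  \<open>S\<close> is a parameter because the patch is later shrunk to a region where
  \<open>dQ\<close> does not vanish.\<close>

locale immersed_patch =
  fixes x :: "real^'m::finite \<Rightarrow> 'b::euclidean_space" and S :: "(real^'m) set"
  assumes open_S: "open S"
    and smooth_x: "smooth_on S x"
    and inj_x: "u \<in> S \<Longrightarrow> inj (frechet_derivative x (at u))"
begin

abbreviation X :: "real^'m \<Rightarrow> real^'m \<Rightarrow> 'b" where "X v \<equiv> dir_deriv v x"
abbreviation H :: "real^'m \<Rightarrow> 'b" where "H \<equiv> mean_curvature x"
abbreviation B :: "real^'m \<Rightarrow> real^'m \<Rightarrow> real^'m \<Rightarrow> 'b" where "B \<equiv> second_fundamental_form x"

lemma x_differentiable: "u \<in> S \<Longrightarrow> x differentiable (at u)"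
  by (rule smooth_on_differentiable[OF smooth_x])

lemma linear_X: "u \<in> S \<Longrightarrow> linear (\<lambda>v. X v u)"
  by (rule linear_dir_deriv[OF x_differentiable])

lemma X_eq_0_iff: "u \<in> S \<Longrightarrow> X v u = 0 \<longleftrightarrow> v = 0"
  using linear_injective_0[OF linear_frechet_derivative[OF x_differentiable]] inj_x
    linear_0[OF linear_X] by (auto simp: dir_deriv_def)

lemma smooth_X: "smooth_on S (X v)"
  by (rule smooth_on_dir_deriv[OF smooth_x])

lemma X_commute: "u \<in> S \<Longrightarrow> dir_deriv v (X w) u = dir_deriv w (X v) u"
  by (rule dir_deriv_commute[OF open_S _ smooth_x])

lemma metric_inv_symmetric:
  assumes "u \<in> S" shows "metric_inv x u $ i $ j = metric_inv x u $ j $ i"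
proof -
  let ?C = "metric_inv x u" and ?G = "induced_metric x u"
  have "transpose ?G = ?G" by (simp add: transpose_def induced_metric_def vec_eq_iff inner_commute)
  then have "transpose ?C ** ?G = mat 1"
    using metric_inv(1)[OF x_differentiable inj_x] assms
    by (metis matrix_transpose_mul transpose_mat)
  then have "transpose ?C = ?C"
    using metric_inv(1)[OF x_differentiable inj_x] assms
    by (metis matrix_mul_assoc matrix_mul_lid matrix_mul_rid)
  then have "transpose ?C $ j $ i = ?C $ j $ i" by simp
  then show ?thesis by (simp add: transpose_def)
qed

text \<open>A column of the inverse solves a linear system with a unit vector on the right, so
  Cramer's rule writes each entry as a quotient of determinants with smooth entries.\<close>

lemma smooth_metric_inv: "smooth_on S (\<lambda>u. metric_inv x u $ i $ j)"
proof -
  let ?D = "\<lambda>u. det (\<chi> k l. if l = i then (axis j 1 :: real^'m) $ k else induced_metric x u $ k $ l)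
    / det (induced_metric x u)"
  have G: "smooth_on S (\<lambda>u. induced_metric x u $ k $ l)" for k l
    unfolding induced_metric_def partial_def vec_lambda_beta
    by (intro smooth_on_intros open_S smooth_x)
  have nz: "det (induced_metric x u) \<noteq> 0" if "u \<in> S" for u
    using metric_inv[OF x_differentiable inj_x] that
    by (metis invertible_def invertible_det_nz)
  have smooth: "smooth_on S (\<lambda>u. det (\<chi> k l. if l = i then (axis j 1 :: real^'m) $ k else induced_metric x u $ k $ l))"
  proof (rule smooth_on_det[OF open_S])
    fix k l
    show "smooth_on S (\<lambda>u. (\<chi> k l. if l = i then (axis j 1 :: real^'m) $ k else induced_metric x u $ k $ l) $ k $ l)"
      by (cases "l = i") (auto simp: smooth_on_const intro: G)
  qed
  have eq: "?D u = metric_inv x u $ i $ j" if "u \<in> S" for u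
  proof -
    have "induced_metric x u *v (\<chi> k. metric_inv x u $ k $ j) = axis j 1"
    proof -
      have "(induced_metric x u ** metric_inv x u) $ k $ j = (mat 1 :: real^'m^'m) $ k $ j" for k
        using metric_inv(1)[OF x_differentiable inj_x] that by simp
      then show ?thesis
        by (simp add: matrix_matrix_mult_def matrix_vector_mult_def vec_eq_iff mat_def axis_def)
    qed
    with cramer[OF nz[OF that]] show ?thesis by (simp add: vec_eq_iff)
  qed
  show ?thesis
    by (rule smooth_on_cong[OF open_S smooth_on_divide[OF open_S smooth smooth_on_det[OF open_S G] nz] eq])
qed

lemma smooth_metric_trace:
  assumes "\<And>v w. smooth_on S (\<lambda>u. T u v w)"
  shows "smooth_on S (\<lambda>u. metric_trace x u (T u))"
  unfolding metric_trace_def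
  by (intro smooth_on_intros open_S smooth_metric_inv assms)

lemma smooth_gradient: "smooth_on S h \<Longrightarrow> smooth_on S (gradient x h)"
  unfolding gradient_def[abs_def]
  by (intro smooth_metric_trace smooth_on_intros open_S smooth_x)

lemma normal_part_eq:
  assumes "u \<in> S"
  shows "normal_part x u y = y - (\<Sum>i\<in>UNIV. (\<Sum>j\<in>UNIV. metric_inv x u $ i $ j *
    (y \<bullet> X (axis j 1) u)) *\<^sub>R X (axis i 1) u)"
  unfolding normal_part_def
  by (subst dir_deriv_eq_sum_partial[OF x_differentiable[OF assms]])
    (simp add: matrix_vector_mult_def partial_def)

lemma smooth_second_fundamental_form: "smooth_on S (\<lambda>u. B u v w)"
proof -
  have "smooth_on S (\<lambda>u. dir_deriv v (X w) u - (\<Sum>i\<in>UNIV. (\<Sum>j\<in>UNIV. metric_inv x u $ i $ j *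
      (dir_deriv v (X w) u \<bullet> X (axis j 1) u)) *\<^sub>R X (axis i 1) u))"
    by (intro smooth_on_intros open_S smooth_x smooth_metric_inv)
  then show ?thesis
    by (rule smooth_on_cong[OF open_S])
      (simp add: second_fundamental_form_def normal_part_eq)
qed

lemma smooth_mean_curvature: "smooth_on S H"
  unfolding mean_curvature_def[abs_def]
  by (intro smooth_on_scaleR smooth_on_const smooth_metric_trace smooth_second_fundamental_form open_S)

lemma metric_trace_metric:
  assumes "u \<in> S" shows "metric_trace x u (\<lambda>v w. X v u \<bullet> X w u) = real CARD('m)"
proof -
  have "(\<Sum>j\<in>UNIV. metric_inv x u $ i $ j * (X (axis j 1) u \<bullet> X (axis i 1) u)) = 1" for i
  proof -
    have "(metric_inv x u ** induced_metric x u) $ i $ i = (mat 1 :: real^'m^'m) $ i $ i"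
      using metric_inv(2)[OF x_differentiable inj_x] assms by simp
    then show ?thesis
      by (simp add: matrix_matrix_mult_def induced_metric_def partial_def mat_def)
  qed
  then show ?thesis by (simp add: metric_trace_def inner_commute)
qed

lemma gradient_tangent:
  assumes "u \<in> S" obtains w where "gradient x h u = X w u"
proof
  show "gradient x h u = X (metric_trace x u (\<lambda>v w. dir_deriv v h u *\<^sub>R w)) u"
    by (simp add: gradient_def metric_trace_def linear_sum[OF linear_X] linear_cmul[OF linear_X] assms)
qed

lemma gradient_inner_X:
  assumes u: "u \<in> S" and h: "h differentiable (at u)"
  shows "gradient x h u \<bullet> X v u = dir_deriv v h u"
proof -
  have *: "gradient x h u \<bullet> X (axis k 1) u = dir_deriv (axis k 1) h u" for k
  proof -
    have "gradient x h u \<bullet> X (axis k 1) u = (\<Sum>i\<in>UNIV. dir_deriv (axis i 1) h u *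
        (\<Sum>j\<in>UNIV. metric_inv x u $ i $ j * (X (axis j 1) u \<bullet> X (axis k 1) u)))"
      by (simp add: gradient_def metric_trace_def inner_sum_left sum_distrib_left mult_ac)
    also have "\<dots> = (\<Sum>i\<in>UNIV. dir_deriv (axis i 1) h u * (metric_inv x u ** induced_metric x u) $ i $ k)"
      by (simp add: matrix_matrix_mult_def induced_metric_def partial_def)
    also have "\<dots> = dir_deriv (axis k 1) h u"
      by (simp add: metric_inv(2)[OF x_differentiable inj_x] u mat_def if_distrib cong: if_cong)
    finally show ?thesis .
  qed
  show ?thesis
    unfolding dir_deriv_eq_sum_partial[OF h, of v] dir_deriv_eq_sum_partial[OF x_differentiable[OF u], of v]
    by (simp add: inner_sum_right * partial_def)
qed

lemma metric_trace_gradient_left: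
  assumes "u \<in> S"
  shows "metric_trace x u (\<lambda>v w. dir_deriv w h u *\<^sub>R X v u) = gradient x h u"
  unfolding gradient_def metric_trace_def
  by (subst sum.swap) (simp add: metric_inv_symmetric[OF assms])

lemma metric_trace_dir_deriv_square:
  assumes u: "u \<in> S" and h: "h differentiable (at u)"
  shows "metric_trace x u (\<lambda>v w. dir_deriv v h u * dir_deriv w h u) = gradient x h u \<bullet> gradient x h u"
proof -
  have "metric_trace x u (\<lambda>v w. dir_deriv v h u * dir_deriv w h u)
      = metric_trace x u (\<lambda>v w. dir_deriv v h u *\<^sub>R X w u \<bullet> gradient x h u)"
    by (rule metric_trace_cong) (simp add: gradient_inner_X[OF u h, symmetric] inner_commute)
  then show ?thesis
    by (simp only: metric_trace_inner_left) (simp add: gradient_def)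
qed

text \<open>Each component of \<open>h\<close> in the standard basis contributes the squared length
  of a gradient; this avoids choosing an orthonormal tangent frame.\<close>

lemma metric_trace_inner_nonneg:
  assumes u: "u \<in> S" and h: "h differentiable (at u)"
  shows "0 \<le> metric_trace x u (\<lambda>v w. dir_deriv v h u \<bullet> (dir_deriv w h u :: 'c::euclidean_space))"
proof -
  have D: "((\<lambda>y. h y \<bullet> b) has_derivative (\<lambda>v. dir_deriv v h u \<bullet> b)) (at u)" for b
    by (rule has_derivative_inner_left[OF has_derivative_dir_deriv[OF h]])
  have "metric_trace x u (\<lambda>v w. dir_deriv v h u \<bullet> dir_deriv w h u)
      = (\<Sum>b\<in>Basis. metric_trace x u (\<lambda>v w. dir_deriv v (\<lambda>y. h y \<bullet> b) u * dir_deriv w (\<lambda>y. h y \<bullet> b) u))"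
    unfolding metric_trace_sum[symmetric] dir_deriv_eq[OF D] by (subst euclidean_inner) (rule refl)
  also have "\<dots> \<ge> 0"
    using D by (intro sum_nonneg) (subst metric_trace_dir_deriv_square[OF u], auto simp: differentiable_def)
  finally show ?thesis .
qed

lemma normal_part_inner:
  assumes "u \<in> S" "\<And>v. z \<bullet> X v u = 0"
  shows "z \<bullet> normal_part x u y = z \<bullet> y"
  using assms by (simp add: normal_part_def inner_diff_right)

lemma B_inner_X: "u \<in> S \<Longrightarrow> B u v w \<bullet> X z u = 0"
  unfolding second_fundamental_form_def by (rule normal_part_orthogonal[OF x_differentiable inj_x])

text \<open>Against normal vectors \<open>B\<close> can be traded for plain second derivatives of
  \<open>x\<close>, to which the product rule applies directly.\<close>

lemma inner_B:
  assumes "u \<in> S" "\<And>v. z \<bullet> X v u = 0"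
  shows "z \<bullet> B u v w = z \<bullet> dir_deriv v (X w) u"
  unfolding second_fundamental_form_def by (rule normal_part_inner[OF assms])

lemma metric_trace_B: "metric_trace x u (B u) = real CARD('m) *\<^sub>R H u"
  by (simp add: mean_curvature_def)

lemma mean_curvature_inner_X: "u \<in> S \<Longrightarrow> H u \<bullet> X v u = 0"
  by (simp add: mean_curvature_def metric_trace_inner_left[symmetric] B_inner_X) (simp add: metric_trace_def)

text \<open>Koszul's computation: of the six terms in the three metric derivatives, four cancel by
  symmetry of second derivatives and the other two agree. Used to absorb the Christoffel terms of
  the Laplacian.\<close>

lemma dir_deriv_X_eq:
  assumes u: "u \<in> S"
  shows "dir_deriv (axis i 1) (X (axis j 1)) u
    = B u (axis i 1) (axis j 1) + (\<Sum>k\<in>UNIV. christoffel x u k i j *\<^sub>R X (axis k 1) u)"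
proof -
  let ?y = "dir_deriv (axis i 1) (X (axis j 1)) u"
  have D: "partial i (\<lambda>v. induced_metric x v $ j $ l) u
      = dir_deriv (axis i 1) (X (axis j 1)) u \<bullet> X (axis l 1) u
        + X (axis j 1) u \<bullet> dir_deriv (axis i 1) (X (axis l 1)) u" for i j l
    unfolding induced_metric_def partial_def vec_lambda_beta
    by (rule dir_deriv_eq)
      (auto intro!: derivative_eq_intros smooth_on_has_derivative[OF smooth_X] u simp: inner_commute)
  have "christoffel x u k i j = (\<Sum>l\<in>UNIV. metric_inv x u $ k $ l * (?y \<bullet> X (axis l 1) u))" for k
    unfolding christoffel_def sum_distrib_left
  proof (rule sum.cong[OF refl])
    fix l
    have "partial i (\<lambda>v. induced_metric x v $ j $ l) u + partial j (\<lambda>v. induced_metric x v $ i $ l) u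
        - partial l (\<lambda>v. induced_metric x v $ i $ j) u = 2 * (?y \<bullet> X (axis l 1) u)"
      using X_commute[OF u, of "axis i 1" "axis j 1"] X_commute[OF u, of "axis i 1" "axis l 1"]
        X_commute[OF u, of "axis j 1" "axis l 1"]
      by (simp add: D inner_commute)
    then show "1 / 2 * (metric_inv x u $ k $ l *
       (partial i (\<lambda>v. induced_metric x v $ j $ l) u + partial j (\<lambda>v. induced_metric x v $ i $ l) u
         - partial l (\<lambda>v. induced_metric x v $ i $ j) u)) = metric_inv x u $ k $ l * (?y \<bullet> X (axis l 1) u)"
      by simp
  qed
  then show ?thesis
    by (simp add: second_fundamental_form_def normal_part_eq[OF u])
qed

abbreviation Q :: "real^'m \<Rightarrow> real" where "Q \<equiv> \<lambda>u. H u \<bullet> H u"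
abbreviation \<theta> :: "real^'m \<Rightarrow> real^'m \<Rightarrow> real" where "\<theta> v \<equiv> dir_deriv v Q"

lemma smooth_Q: "smooth_on S Q"
  by (intro smooth_on_intros open_S smooth_mean_curvature)

lemma linear_\<theta>: "u \<in> S \<Longrightarrow> linear (\<lambda>v. \<theta> v u)"
  by (rule linear_dir_deriv[OF smooth_on_differentiable[OF smooth_Q]])

lemma H_inner_dir_deriv_H: "u \<in> S \<Longrightarrow> 2 * (H u \<bullet> dir_deriv v H u) = \<theta> v u"
  using dir_deriv_inner[OF open_S _ smooth_mean_curvature smooth_mean_curvature refl, of u v]
  by (simp add: inner_commute)

text \<open>In codimension two the tangent space and \<open>H u\<close> span a hyperplane; \<eta> is
  its unit normal.\<close>

lemma normal_line:
  assumes u: "u \<in> S" and codim: "DIM('b) = CARD('m) + 2" and H: "H u \<noteq> 0"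
  obtains \<eta> where "\<eta> \<bullet> \<eta> = 1" "\<eta> \<bullet> H u = 0" "\<And>v. \<eta> \<bullet> X v u = 0"
    "\<And>y. (\<And>v. y \<bullet> X v u = 0) \<Longrightarrow> y \<bullet> H u = 0 \<Longrightarrow> y = (y \<bullet> \<eta>) *\<^sub>R \<eta>"
proof -
  let ?T = "range (\<lambda>v. X v u)" and ?U = "insert (H u) (range (\<lambda>v. X v u))"
  have "inj (\<lambda>v. X v u)" using X_eq_0_iff[OF u] linear_injective_0[OF linear_X[OF u]] by simp
  then have "dim ?T = CARD('m)"
    using dim_image_eq[OF linear_X[OF u], of UNIV] by (simp add: span_UNIV)
  moreover have "H u \<notin> span ?T"
  proof
    assume "H u \<in> span ?T"
    then have "orthogonal (H u) (H u)"
      by (rule orthogonal_to_span) (auto simp: orthogonal_def mean_curvature_inner_X[OF u])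
    with H show False by (simp add: orthogonal_def)
  qed
  ultimately have "dim ?U = DIM('b) - 1" by (simp add: dim_insert codim)
  then obtain a where a: "a \<noteq> 0" "span ?U = {y. a \<bullet> y = 0}" by (rule lowdim_eq_hyperplane)
  define \<eta> where "\<eta> = a /\<^sub>R norm a"
  have \<eta>: "\<eta> \<bullet> y = 0 \<longleftrightarrow> y \<in> span ?U" for y using a by (simp add: \<eta>_def)
  have \<eta>1: "\<eta> \<bullet> \<eta> = 1"
    using a(1) by (simp add: \<eta>_def power2_norm_eq_inner[symmetric] power2_eq_square)
  have \<eta>0: "\<eta> \<bullet> y = 0" if "y \<in> ?U" for y using \<eta> that by (simp add: span_base)
  show ?thesis
  proof (rule that)
    fix y assume y: "\<And>v. y \<bullet> X v u = 0" "y \<bullet> H u = 0"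
    let ?z = "y - (y \<bullet> \<eta>) *\<^sub>R \<eta>"
    have "?z \<in> span ?U" using \<eta>1 by (simp add: \<eta>[symmetric] inner_diff_right inner_commute)
    then have "orthogonal ?z ?z"
      by (rule orthogonal_to_span) (use y \<eta>0 in \<open>auto simp: orthogonal_def inner_diff_left\<close>)
    then show "y = (y \<bullet> \<eta>) *\<^sub>R \<eta>" by (simp add: orthogonal_def)
  qed (use \<eta>1 \<eta>0 in auto)
qed

end

section \<open>Pseudo-umbilical biharmonic patches\<close>

locale pseudo_umbilical_biharmonic_patch = immersed_patch x S
  for x :: "real^'m::finite \<Rightarrow> 'b::euclidean_space" and S +
  assumes umbilical: "u \<in> S \<Longrightarrow> shape_operator x u (H u) v = (norm (H u))\<^sup>2 *\<^sub>R v"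
    and biharmonic: "u \<in> S \<Longrightarrow> laplacian x H u = 0"
begin

text \<open>Pseudo-umbilicity says that the \<open>H\<close>-component of \<open>B\<close> is
  \<open>Q\<close> times the metric, and \<open>inner_B\<close> rewrites \<open>B\<close>.\<close>

lemma H_inner_dir_deriv_X:
  assumes u: "u \<in> S" shows "H u \<bullet> dir_deriv v (X w) u = Q u * (X v u \<bullet> X w u)"
  using shape_operator[OF open_S u smooth_x inj_x[OF u], of "H u" v w]
    inner_B[OF u mean_curvature_inner_X[OF u], of v w]
  by (simp add: umbilical[OF u] linear_cmul[OF linear_X[OF u]] power2_norm_eq_inner inner_commute)

lemma dir_deriv_H_inner_X:
  assumes u: "u \<in> S" shows "dir_deriv v H u \<bullet> X w u = - Q u * (X v u \<bullet> X w u)"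
  using dir_deriv_inner[OF open_S u smooth_mean_curvature smooth_X mean_curvature_inner_X, of v w]
  by (simp add: H_inner_dir_deriv_X[OF u] dir_deriv_const)

lemma mean_curvature_eq_0_if_dQ_eq_0:
  assumes W: "open W" "W \<subseteq> S" and u: "u \<in> W" and dQ: "\<And>p v. p \<in> W \<Longrightarrow> \<theta> v p = 0"
  shows "H u = 0"
proof -
  have uS: "u \<in> S" using W u by auto
  have H0: "H p \<bullet> dir_deriv v H p = 0" if "p \<in> W" for p v
    using H_inner_dir_deriv_H[of p v] dQ[OF that, of v] that W by auto
  have HD: "smooth_on W H" "smooth_on W (dir_deriv v H)" for v
    using smooth_on_subset[OF smooth_mean_curvature W(2)] by (auto intro: smooth_on_dir_deriv)
  have D2: "dir_deriv v (dir_deriv w H) u \<bullet> H u = - (dir_deriv v H u \<bullet> dir_deriv w H u)" for v w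
    using dir_deriv_inner[OF W(1) u HD(1) HD(2) H0, of v w] by (simp add: dir_deriv_const inner_commute)
  have "0 = laplacian x H u \<bullet> H u" by (simp add: biharmonic[OF uS])
  \<comment> \<open>Paired with \<open>H u\<close>, the Christoffel terms vanish by
    \<open>H0\<close>, and \<open>D2\<close> turns the second derivatives into products of first
    ones.\<close>
  also have "\<dots> = metric_trace x u (\<lambda>v w. - (dir_deriv v H u \<bullet> dir_deriv w H u))"
    using H0[OF u, unfolded inner_commute[of "H u"]]
    by (simp add: laplacian_def metric_trace_def inner_sum_left inner_diff_left partial_eq_dir_deriv D2)
  finally have tr: "metric_trace x u (\<lambda>v w. dir_deriv v H u \<bullet> dir_deriv w H u) = 0"
    using metric_trace_scaleR[of x u "-1" "\<lambda>v w. dir_deriv v H u \<bullet> dir_deriv w H u"] by simp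
  \<comment> \<open>\<open>Q\<close> is frozen at its value at \<open>u\<close>, so the derivative
    of \<open>h\<close> at \<open>u\<close> is the normal part of that of \<open>H\<close>. Removing
    the tangential part \<open>- Q u *\<^sub>R X v u\<close> lowers the zero trace \<open>tr\<close>
    by \<open>Q\<close> squared times the dimension, against nonnegativity.\<close>
  define h where "h p = H p + Q u *\<^sub>R x p" for p
  have h: "(h has_derivative (\<lambda>v. dir_deriv v H u + Q u *\<^sub>R X v u)) (at u)"
    unfolding h_def[abs_def]
    by (auto intro!: derivative_eq_intros smooth_on_has_derivative[OF smooth_mean_curvature uS]
        smooth_on_has_derivative[OF smooth_x uS])
  have "dir_deriv v h u \<bullet> dir_deriv w h u
      = dir_deriv v H u \<bullet> dir_deriv w H u - ((Q u)\<^sup>2 *\<^sub>R (X v u \<bullet> X w u))" for v w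
    using dir_deriv_H_inner_X[OF uS, of v w] dir_deriv_H_inner_X[OF uS, of w v]
    by (simp add: dir_deriv_eq[OF h] inner_add_left inner_add_right inner_commute power2_eq_square
        algebra_simps)
  then have "metric_trace x u (\<lambda>v w. dir_deriv v h u \<bullet> dir_deriv w h u) = - (Q u)\<^sup>2 * real CARD('m)"
    by (simp only: metric_trace_diff metric_trace_scaleR tr metric_trace_metric[OF uS]) simp
  then have "(Q u)\<^sup>2 * real CARD('m) \<le> 0"
    using metric_trace_inner_nonneg[OF uS, of h] h by (auto simp: differentiable_def)
  then have "Q u = 0" by (simp add: mult_le_0_iff)
  then show ?thesis by simp
qed

end

section \<open>Patches with varying mean curvature\<close>

text \<open>One fixed direction \<open>v0\<close> on which \<open>dQ\<close> is nonzero throughout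
  the patch allows smooth division by \<open>dQ\<close>.\<close>

locale varying_curvature_patch = pseudo_umbilical_biharmonic_patch x S
  for x :: "real^4 \<Rightarrow> real^6" and S +
  fixes v0 :: "real^4"
  assumes dQ_nonzero: "u \<in> S \<Longrightarrow> \<theta> v0 u \<noteq> 0"
begin

lemma H_nonzero: "u \<in> S \<Longrightarrow> H u \<noteq> 0"
  using dQ_nonzero[of u] H_inner_dir_deriv_H[of u v0] by auto

lemma Q_pos: "u \<in> S \<Longrightarrow> 0 < Q u"
  by (simp add: H_nonzero)

lemma linear_combination_theta:
  assumes "u \<in> S" "linear L" "\<And>v. \<theta> v u = 0 \<Longrightarrow> L v = 0"
  shows "L v = \<theta> v u *\<^sub>R ((1 / \<theta> v0 u) *\<^sub>R L v0)"
proof -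
  have "L (v - (\<theta> v u / \<theta> v0 u) *\<^sub>R v0) = 0"
    using dQ_nonzero[OF assms(1)]
    by (intro assms(3)) (simp add: linear_diff[OF linear_\<theta>] linear_cmul[OF linear_\<theta>] assms(1))
  then show ?thesis by (simp add: linear_diff[OF assms(2)] linear_cmul[OF assms(2)])
qed

lemma kernel_theta_nontrivial:
  assumes "u \<in> S" obtains v where "v \<noteq> 0" "\<theta> v u = 0"
  by (rule common_zero_of_linear_functionals[OF linear_\<theta>[OF assms] linear_\<theta>[OF assms]]) (auto intro: that)

text \<open>By \<open>dir_deriv_H\<close> below, \<open>J\<close> does not depend on \<open>v0\<close>: it is the derivative of \<open>H\<close> with respect to \<open>Q\<close>
  modulo tangent vectors. The vector \<open>M\<close> is related to \<open>J\<close>, and \<open>N1\<close> to \<open>N\<close>, in the same way.\<close>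

definition J :: "real^4 \<Rightarrow> real^6" where
  "J u = (1 / \<theta> v0 u) *\<^sub>R (dir_deriv v0 H u + Q u *\<^sub>R X v0 u)"

lemma smooth_theta_inverse: "smooth_on S (\<lambda>u. 1 / \<theta> v0 u)"
  using smooth_on_divide[OF open_S smooth_on_const smooth_on_dir_deriv[OF smooth_Q] dQ_nonzero] .

lemma smooth_J: "smooth_on S J"
  unfolding J_def[abs_def]
  by (intro smooth_on_intros smooth_theta_inverse open_S smooth_mean_curvature smooth_x)

text \<open>In codimension two the part of $\nabla^\perp H$ orthogonal to \<open>H\<close> is \<open>\<tau> v *\<^sub>R \<eta>\<close>, and the
  Codazzi equation forces the kernel of \<open>\<tau>\<close> into that of \<open>dQ\<close>.\<close>

lemma dir_deriv_H:
  assumes u: "u \<in> S"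
  shows "dir_deriv v H u = - Q u *\<^sub>R X v u + \<theta> v u *\<^sub>R J u"
proof -
  \<comment> \<open>The normal part of the derivative of \<open>H\<close>: by
    \<open>dir_deriv_H_inner_X\<close> the tangential part is
    \<open>- Q p *\<^sub>R X v p\<close>.\<close>
  define N where "N v p = dir_deriv v H p + Q p *\<^sub>R X v p" for v p
  have linN: "linear (\<lambda>v. N v u)"
    unfolding N_def
    by (intro linear_compose_add linear_compose_scale_right linear_X[OF u]
        linear_dir_deriv_on[OF smooth_mean_curvature u])
  have smoothN: "smooth_on S (N v)" for v
    unfolding N_def[abs_def] by (intro smooth_on_intros open_S smooth_mean_curvature smooth_x)
  have NX: "N v p \<bullet> X w p = 0" if "p \<in> S" for v w p
    by (simp add: N_def inner_add_left dir_deriv_H_inner_X[OF that])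
  have NH: "N v u \<bullet> H u = \<theta> v u / 2" for v
    using H_inner_dir_deriv_H[OF u, of v]
    by (simp add: N_def inner_add_left inner_commute[of "dir_deriv v H u"] inner_commute[of "X v u"] mean_curvature_inner_X[OF u])
  have DN: "dir_deriv a (N b) u = dir_deriv a (dir_deriv b H) u + \<theta> a u *\<^sub>R X b u + Q u *\<^sub>R dir_deriv a (X b) u"
    for a b
    unfolding N_def[abs_def]
    by (rule dir_deriv_eq[THEN trans],
        rule has_derivative_add[OF
          smooth_on_has_derivative[OF smooth_on_dir_deriv[OF smooth_mean_curvature] u]
          has_derivative_scaleR[OF smooth_on_has_derivative[OF smooth_Q u]
            smooth_on_has_derivative[OF smooth_X u]]]) simp
  obtain \<eta> where \<eta>: "\<eta> \<bullet> \<eta> = 1" "\<eta> \<bullet> H u = 0" "\<And>v. \<eta> \<bullet> X v u = 0"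
    "\<And>y. (\<And>v. y \<bullet> X v u = 0) \<Longrightarrow> y \<bullet> H u = 0 \<Longrightarrow> y = (y \<bullet> \<eta>) *\<^sub>R \<eta>"
    using normal_line[OF u _ H_nonzero[OF u]] by auto
  define \<tau> where "\<tau> v = N v u \<bullet> \<eta>" for v
  have lin\<tau>: "linear \<tau>"
    unfolding \<tau>_def by (rule linearI) (simp_all add: linear_add[OF linN] linear_cmul[OF linN] inner_add_left)
  have N_eq: "N v u = (\<theta> v u / (2 * Q u)) *\<^sub>R H u + \<tau> v *\<^sub>R \<eta>" for v
  proof -
    have "N v u - (\<theta> v u / (2 * Q u)) *\<^sub>R H u
        = ((N v u - (\<theta> v u / (2 * Q u)) *\<^sub>R H u) \<bullet> \<eta>) *\<^sub>R \<eta>"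
      by (rule \<eta>(4)) (use Q_pos[OF u] in
        \<open>simp_all add: inner_diff_left NX[OF u] mean_curvature_inner_X[OF u] NH\<close>)
    also have "\<dots> = \<tau> v *\<^sub>R \<eta>"
      by (simp add: \<tau>_def inner_diff_left inner_commute[of "H u" \<eta>] \<eta>(2))
    finally show ?thesis by (simp add: algebra_simps)
  qed
  \<comment> \<open>In the antisymmetrized derivative of \<open>N\<close> the second derivatives of
    \<open>H\<close> and of \<open>x\<close> cancel. Orthogonality of \<open>N\<close> to
    \<open>X c\<close> then moves the derivative onto \<open>X c\<close>.\<close>
  have codazzi: "N a u \<bullet> dir_deriv b (X c) u - N b u \<bullet> dir_deriv a (X c) u
      = \<theta> a u * (X b u \<bullet> X c u) - \<theta> b u * (X a u \<bullet> X c u)" for a b c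
  proof -
    have "dir_deriv a (N b) u - dir_deriv b (N a) u = \<theta> a u *\<^sub>R X b u - \<theta> b u *\<^sub>R X a u"
      using dir_deriv_commute[OF open_S u smooth_mean_curvature, of a b] X_commute[OF u, of a b]
      by (simp add: DN)
    then have "(dir_deriv a (N b) u - dir_deriv b (N a) u) \<bullet> X c u
        = \<theta> a u * (X b u \<bullet> X c u) - \<theta> b u * (X a u \<bullet> X c u)"
      by (simp add: inner_diff_left)
    moreover have "dir_deriv a (N b) u \<bullet> X c u + N b u \<bullet> dir_deriv a (X c) u = 0" for a b
      using dir_deriv_inner[OF open_S u smoothN smooth_X NX, of a b c] by (simp add: dir_deriv_const)
    note this[of a b] this[of b a]
    ultimately show ?thesis by (simp add: inner_diff_left)
  qed
  have \<tau>_kernel: "\<theta> a u = 0" if a: "\<tau> a = 0" for a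
  proof -
    obtain b where b: "b \<noteq> 0" "\<tau> b = 0" "X b u \<bullet> X a u = 0"
      by (rule common_zero_of_linear_functionals[OF lin\<tau>, of "\<lambda>b. X b u \<bullet> X a u"])
        (auto intro!: linearI simp: linear_add[OF linear_X[OF u]] linear_cmul[OF linear_X[OF u]] inner_add_left)
    \<comment> \<open>On the kernel of \<tau> only the \<open>H\<close>-component of
      \<open>N\<close> survives. For \<open>a\<close>, \<open>b\<close>, \<open>b\<close> the left
      side of \<open>codazzi\<close> is half of
      \<open>\<theta> a u * (X b u \<bullet> X b u)\<close>, the right side the whole of it.\<close>
    have "N v u \<bullet> dir_deriv w (X b) u = \<theta> v u / 2 * (X w u \<bullet> X b u)" if "\<tau> v = 0" for v w
      using Q_pos[OF u] that by (simp add: N_eq H_inner_dir_deriv_X[OF u] field_simps)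
    from this[OF a, of b] this[OF b(2), of a] have "\<theta> a u * (X b u \<bullet> X b u) = 0"
      using codazzi[of a b b] b(3) by (simp add: inner_commute)
    then show ?thesis using X_eq_0_iff[OF u] b(1) by simp
  qed
  have "N v u = 0" if v: "\<theta> v u = 0" for v
  proof (rule ccontr)
    assume "N v u \<noteq> 0"
    then have "\<tau> v \<noteq> 0" using N_eq[of v] v by auto
    \<comment> \<open>Correcting \<open>v0\<close> by a multiple of \<open>v\<close> gives an
      element of the kernel of \<tau> on which \<open>dQ\<close> still takes its nonzero value at
      \<open>v0\<close>.\<close>
    then have "\<tau> (v0 - (\<tau> v0 / \<tau> v) *\<^sub>R v) = 0"
      by (simp add: linear_diff[OF lin\<tau>] linear_cmul[OF lin\<tau>])
    from \<tau>_kernel[OF this] show False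
      using dQ_nonzero[OF u] v by (simp add: linear_diff[OF linear_\<theta>[OF u]] linear_cmul[OF linear_\<theta>[OF u]])
  qed
  from linear_combination_theta[OF u linN this, of v] show ?thesis
    by (simp add: N_def J_def algebra_simps)
qed

text \<open>The symmetry of the second derivative of \<open>F\<close> propagates the form
  $dF = f\,dx + dQ \otimes F'$ to \<open>F'\<close>.\<close>

lemma derivative_step:
  assumes F: "smooth_on S F" and F': "smooth_on S F'" and f: "smooth_on S f"
    and dF: "\<And>v p. p \<in> S \<Longrightarrow> dir_deriv v F p = f p *\<^sub>R X v p + \<theta> v p *\<^sub>R F' p"
    and u: "u \<in> S" and df: "\<And>v. dir_deriv v f u = c * \<theta> v u"
  shows "dir_deriv v F' u
    = c *\<^sub>R X v u + \<theta> v u *\<^sub>R ((1 / \<theta> v0 u) *\<^sub>R (dir_deriv v0 F' u - c *\<^sub>R X v0 u))"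
proof -
  have D: "dir_deriv a (dir_deriv b F) u = (c * \<theta> a u) *\<^sub>R X b u + f u *\<^sub>R dir_deriv a (X b) u
      + dir_deriv a (\<theta> b) u *\<^sub>R F' u + \<theta> b u *\<^sub>R dir_deriv a F' u" for a b
  proof -
    have "dir_deriv a (dir_deriv b F) u = dir_deriv a (\<lambda>p. f p *\<^sub>R X b p + \<theta> b p *\<^sub>R F' p) u"
      by (rule dir_deriv_cong[OF open_S u dF])
    also have "\<dots> = (c * \<theta> a u) *\<^sub>R X b u + f u *\<^sub>R dir_deriv a (X b) u
      + dir_deriv a (\<theta> b) u *\<^sub>R F' u + \<theta> b u *\<^sub>R dir_deriv a F' u"
      unfolding df[symmetric]
      by (rule dir_deriv_eq[THEN trans],
          rule has_derivative_add[OF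
            has_derivative_scaleR[OF smooth_on_has_derivative[OF f u] smooth_on_has_derivative[OF smooth_X u]]
            has_derivative_scaleR[OF smooth_on_has_derivative[OF smooth_on_dir_deriv[OF smooth_Q] u]
              smooth_on_has_derivative[OF F' u]]]) simp
    finally show ?thesis .
  qed
  \<comment> \<open>Equating the second derivatives of \<open>F\<close> in the two orders, those of
    \<open>x\<close> and \<open>Q\<close> cancel; only first derivatives of \<open>F'\<close>
    remain.\<close>
  have "(c * \<theta> v0 u) *\<^sub>R X v u + \<theta> v u *\<^sub>R dir_deriv v0 F' u
      = (c * \<theta> v u) *\<^sub>R X v0 u + \<theta> v0 u *\<^sub>R dir_deriv v F' u"
    using dir_deriv_commute[OF open_S u F, of v0 v] dir_deriv_commute[OF open_S u smooth_Q, of v0 v]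
      X_commute[OF u, of v0 v] by (simp add: D)
  then have "\<theta> v0 u *\<^sub>R dir_deriv v F' u = \<theta> v0 u *\<^sub>R (c *\<^sub>R X v u
      + \<theta> v u *\<^sub>R ((1 / \<theta> v0 u) *\<^sub>R (dir_deriv v0 F' u - c *\<^sub>R X v0 u)))"
    using dQ_nonzero[OF u] by (simp add: algebra_simps)
  then show ?thesis using dQ_nonzero[OF u] by (simp only: scaleR_cancel_left) simp
qed

definition M :: "real^4 \<Rightarrow> real^6" where
  "M u = (1 / \<theta> v0 u) *\<^sub>R (dir_deriv v0 J u + X v0 u)"

lemma smooth_M: "smooth_on S M"
  unfolding M_def[abs_def]
  by (intro smooth_on_intros smooth_theta_inverse open_S smooth_J smooth_x)

lemma dir_deriv_J: "u \<in> S \<Longrightarrow> dir_deriv v J u = - X v u + \<theta> v u *\<^sub>R M u"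
  using derivative_step[OF smooth_mean_curvature smooth_J smooth_on_minus[OF open_S smooth_Q] dir_deriv_H,
      of u "-1" v] dir_deriv_eq[OF has_derivative_minus[OF smooth_on_has_derivative[OF smooth_Q]]]
  by (simp add: M_def)

text \<open>The coefficient of \<open>X v\<close> in \<open>dir_deriv_J\<close> is the constant -1,
  so \<open>c = 0\<close> in \<open>derivative_step\<close> and the tangential term
  disappears.\<close>

lemma dir_deriv_M: "u \<in> S \<Longrightarrow> dir_deriv v M u = \<theta> v u *\<^sub>R ((1 / \<theta> v0 u) *\<^sub>R dir_deriv v0 M u)"
  using derivative_step[OF smooth_J smooth_M smooth_on_const[of S "-1"], of u 0 v]
  by (simp add: dir_deriv_J dir_deriv_const)

lemma J_inner_H: assumes u: "u \<in> S" shows "J u \<bullet> H u = 1 / 2"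
  using H_inner_dir_deriv_H[OF u, of v0] dQ_nonzero[OF u]
  by (simp add: J_def inner_add_left inner_commute[of "dir_deriv v0 H u"] inner_commute[of "X v0 u"]
      mean_curvature_inner_X[OF u] field_simps)

lemma J_inner_X: assumes u: "u \<in> S" shows "J u \<bullet> X v u = 0"
  by (simp add: J_def inner_add_left dir_deriv_H_inner_X[OF u])

section \<open>The scalar invariants as functions of the squared mean curvature\<close>

text \<open>\<open>\<delta>\<close> is the Laplacian of \<open>Q\<close>, see \<open>laplacian_Q\<close>.\<close>

abbreviation N :: "real^4 \<Rightarrow> real^6" where "N \<equiv> gradient x Q"
abbreviation P :: "real^4 \<Rightarrow> real" where "P \<equiv> \<lambda>u. N u \<bullet> N u"
abbreviation r :: "real^4 \<Rightarrow> real" where "r \<equiv> \<lambda>u. J u \<bullet> J u"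
abbreviation \<rho> :: "real^4 \<Rightarrow> real" where "\<rho> \<equiv> \<lambda>u. J u \<bullet> M u"
abbreviation \<delta> :: "real^4 \<Rightarrow> real" where "\<delta> \<equiv> \<lambda>u. 8 * (Q u)\<^sup>2 + 2 * r u * P u"

lemma smooth_N: "smooth_on S N"
  by (rule smooth_gradient[OF smooth_Q])

lemma N_inner_X: "u \<in> S \<Longrightarrow> N u \<bullet> X v u = \<theta> v u"
  by (rule gradient_inner_X) (auto intro: smooth_on_differentiable[OF smooth_Q])

lemma P_pos: assumes u: "u \<in> S" shows "0 < P u"
  using N_inner_X[OF u, of v0] dQ_nonzero[OF u] by auto

lemma inner_N_normal:
  assumes u: "u \<in> S" and y: "\<And>v. y \<bullet> X v u = 0" shows "y \<bullet> N u = 0"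
  by (rule gradient_tangent[OF u, of Q]) (simp add: y)

text \<open>Differentiating \<open>J \<bullet> X b = 0\<close> expresses second derivatives of
  \<open>x\<close> against \<open>J\<close> through \<open>M\<close>; their symmetry makes
  \<open>M \<bullet> X b\<close> a multiple \<open>m\<close> of \<open>\<theta> b\<close>. The trace
  fixes \<open>m\<close>: four times \<open>H \<bullet> J\<close>, that is 2, equals
  \<open>4 - m * P u\<close>.\<close>

lemma M_inner_X:
  assumes u: "u \<in> S" shows "M u \<bullet> X v u = 2 / P u * \<theta> v u"
proof -
  have JD: "J u \<bullet> dir_deriv a (X b) u = X a u \<bullet> X b u - \<theta> a u * (M u \<bullet> X b u)" for a b
    using dir_deriv_inner[OF open_S u smooth_J smooth_X J_inner_X, of a b]
    by (simp add: dir_deriv_J[OF u] dir_deriv_const inner_add_left inner_diff_left)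
  define m where "m = M u \<bullet> X v0 u / \<theta> v0 u"
  have m: "M u \<bullet> X b u = m * \<theta> b u" for b
    using JD[of v0 b] JD[of b v0] X_commute[OF u, of v0 b] dQ_nonzero[OF u]
    by (simp add: m_def inner_commute[of "X b u" "X v0 u"] field_simps)
  have "4 * (H u \<bullet> J u) = metric_trace x u (\<lambda>v w. B u v w \<bullet> J u)"
    by (simp add: metric_trace_inner_left metric_trace_B)
  also have "\<dots> = metric_trace x u (\<lambda>v w. X v u \<bullet> X w u - m *\<^sub>R (\<theta> v u * \<theta> w u))"
    by (rule metric_trace_cong)
      (simp add: inner_commute[of "B u _ _"] inner_B[OF u J_inner_X[OF u]] JD m)
  also have "\<dots> = 4 - m * P u"
    by (simp only: metric_trace_diff metric_trace_scaleR metric_trace_metric[OF u]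
        metric_trace_dir_deriv_square[OF u smooth_on_differentiable[OF smooth_Q u]]) simp
  finally have "m * P u = 2" using J_inner_H[OF u] by (simp add: inner_commute)
  then show ?thesis using P_pos[OF u] by (simp add: m field_simps)
qed

text \<open>The Christoffel terms turn second derivatives of \<open>x\<close> into \<open>B\<close>
  and those of \<open>Q\<close> into its Hessian. The two mirror-image products of \<open>dQ\<close>
  and \<open>dx\<close> each contribute one \<open>N\<close>.\<close>

lemma laplacian_H:
  assumes u: "u \<in> S"
  shows "laplacian x H u = - (2 *\<^sub>R N u) - (4 * Q u) *\<^sub>R H u + laplacian x Q u *\<^sub>R J u + P u *\<^sub>R M u"
proof -
  let ?T = "\<lambda>v w. - (\<theta> v u *\<^sub>R X w u) - \<theta> w u *\<^sub>R X v u - Q u *\<^sub>R B u v w + (\<theta> v u * \<theta> w u) *\<^sub>R M u"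
  let ?q = "\<lambda>i j. dir_deriv (axis i 1) (\<theta> (axis j 1)) u - (\<Sum>k\<in>UNIV. christoffel x u k i j * \<theta> (axis k 1) u)"
  have D: "dir_deriv a (dir_deriv b H) u = - (\<theta> a u) *\<^sub>R X b u - Q u *\<^sub>R dir_deriv a (X b) u
      + dir_deriv a (\<theta> b) u *\<^sub>R J u + \<theta> b u *\<^sub>R dir_deriv a J u" for a b
  proof -
    have "dir_deriv a (dir_deriv b H) u = dir_deriv a (\<lambda>p. - Q p *\<^sub>R X b p + \<theta> b p *\<^sub>R J p) u"
      by (rule dir_deriv_cong[OF open_S u dir_deriv_H])
    also have "\<dots> = - (\<theta> a u) *\<^sub>R X b u - Q u *\<^sub>R dir_deriv a (X b) u
      + dir_deriv a (\<theta> b) u *\<^sub>R J u + \<theta> b u *\<^sub>R dir_deriv a J u"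
      by (rule dir_deriv_eq[THEN trans],
          rule has_derivative_add[OF
            has_derivative_scaleR[OF has_derivative_minus[OF smooth_on_has_derivative[OF smooth_Q u]]
              smooth_on_has_derivative[OF smooth_X u]]
            has_derivative_scaleR[OF smooth_on_has_derivative[OF smooth_on_dir_deriv[OF smooth_Q] u]
              smooth_on_has_derivative[OF smooth_J u]]]) simp
    finally show ?thesis .
  qed
  have "dir_deriv (axis i 1) (dir_deriv (axis j 1) H) u
      - (\<Sum>k\<in>UNIV. christoffel x u k i j *\<^sub>R dir_deriv (axis k 1) H u)
      = ?T (axis i 1) (axis j 1) + ?q i j *\<^sub>R J u" for i j
  proof -
    have "(\<Sum>k\<in>UNIV. christoffel x u k i j *\<^sub>R dir_deriv (axis k 1) H u)
        = - (Q u *\<^sub>R (\<Sum>k\<in>UNIV. christoffel x u k i j *\<^sub>R X (axis k 1) u))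
          + (\<Sum>k\<in>UNIV. christoffel x u k i j * \<theta> (axis k 1) u) *\<^sub>R J u"
      unfolding dir_deriv_H[OF u]
      by (simp add: scaleR_sum_right scaleR_sum_left sum.distrib sum_negf scaleR_add_right scaleR_diff_right
          sum_subtractf mult.commute)
    then show ?thesis
      by (simp add: D dir_deriv_X_eq[OF u] dir_deriv_J[OF u] algebra_simps)
  qed
  then have "laplacian x H u = metric_trace x u ?T + laplacian x Q u *\<^sub>R J u"
    by (simp add: laplacian_def metric_trace_def partial_eq_dir_deriv scaleR_add_right sum.distrib
        scaleR_sum_left)
  moreover have "metric_trace x u ?T = - (2 *\<^sub>R N u) - (4 * Q u) *\<^sub>R H u + P u *\<^sub>R M u"
  proof -
    have "metric_trace x u (\<lambda>v w. - (\<theta> v u *\<^sub>R X w u)) = - N u"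
      using metric_trace_scaleR[of x u "-1" "\<lambda>v w. \<theta> v u *\<^sub>R X w u"] by (simp add: gradient_def)
    then show ?thesis
      by (simp only: metric_trace_add metric_trace_diff metric_trace_scaleR metric_trace_scaleR_left
          metric_trace_gradient_left[OF u] metric_trace_B
          metric_trace_dir_deriv_square[OF u smooth_on_differentiable[OF smooth_Q u]])
        (simp add: scaleR_2 algebra_simps)
  qed
  ultimately show ?thesis by simp
qed

lemma M_inner_H: assumes u: "u \<in> S" shows "M u \<bullet> H u = - r u"
proof -
  have "dir_deriv v0 J u \<bullet> H u + J u \<bullet> dir_deriv v0 H u = 0"
    using dir_deriv_inner[OF open_S u smooth_J smooth_mean_curvature J_inner_H, of v0]
    by (simp add: dir_deriv_const)
  then have "\<theta> v0 u * (M u \<bullet> H u + r u) = 0"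
    by (simp add: dir_deriv_J[OF u] dir_deriv_H[OF u] inner_add_left inner_diff_left inner_add_right
        inner_diff_right J_inner_X[OF u] mean_curvature_inner_X[OF u] inner_commute[of "X v0 u" "H u"] algebra_simps)
  then show ?thesis using dQ_nonzero[OF u] by simp
qed

lemma laplacian_Q: assumes u: "u \<in> S" shows "laplacian x Q u = \<delta> u"
proof -
  have "H u \<bullet> N u = 0" by (rule inner_N_normal[OF u mean_curvature_inner_X[OF u]])
  then have "- (4 * Q u * Q u) + laplacian x Q u / 2 - P u * r u = 0"
    using arg_cong[OF laplacian_H[OF u], of "\<lambda>y. y \<bullet> H u"] J_inner_H[OF u] M_inner_H[OF u]
    by (simp add: biharmonic[OF u] inner_add_left inner_diff_left inner_commute[of "N u" "H u"])
  then show ?thesis by (simp add: power2_eq_square algebra_simps)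
qed

text \<open>Biharmonicity as a formula for the second-order vector \<open>M\<close>. Read backwards
  as a formula for \<open>N\<close>, it later gives the derivative of \<open>N\<close>.\<close>

lemma PM_eq:
  assumes u: "u \<in> S"
  shows "P u *\<^sub>R M u = 2 *\<^sub>R N u + (4 * Q u) *\<^sub>R H u - \<delta> u *\<^sub>R J u"
  using laplacian_H[OF u] biharmonic[OF u] laplacian_Q[OF u] by (simp add: algebra_simps)

lemma J_inner_N: "u \<in> S \<Longrightarrow> J u \<bullet> N u = 0"
  and H_inner_N: "u \<in> S \<Longrightarrow> H u \<bullet> N u = 0"
  by (auto intro: inner_N_normal J_inner_X mean_curvature_inner_X)

lemma P_rho: assumes u: "u \<in> S" shows "P u * \<rho> u = 2 * Q u - 8 * (Q u)\<^sup>2 * r u - 2 * (r u)\<^sup>2 * P u"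
  using arg_cong[OF PM_eq[OF u], of "\<lambda>y. J u \<bullet> y"] J_inner_H[OF u] J_inner_N[OF u]
  by (simp add: inner_add_right inner_diff_right power2_eq_square algebra_simps)

text \<open>The Gram determinant of \<open>H\<close> and \<open>J\<close> is positive. If
  \<open>J\<close> were parallel to \<open>H\<close>, then for \<open>v\<close> in the kernel of
  \<open>dQ\<close> the product \<open>J u \<bullet> dir_deriv v (X v) u\<close> would be the
  squared length of \<open>X v u\<close> by \<open>dir_deriv_J\<close>, but half of it by
  umbilicity.\<close>

lemma Qr_gt: assumes u: "u \<in> S" shows "1 < 4 * Q u * r u"
proof -
  define z where "z = J u - (1 / (2 * Q u)) *\<^sub>R H u"
  have "z \<noteq> 0"
  proof
    assume "z = 0"
    then have J: "J u = (1 / (2 * Q u)) *\<^sub>R H u" by (simp add: z_def)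
    obtain v where v: "v \<noteq> 0" "\<theta> v u = 0" using kernel_theta_nontrivial[OF u] .
    have "J u \<bullet> dir_deriv v (X v) u = X v u \<bullet> X v u"
      using dir_deriv_inner[OF open_S u smooth_J smooth_X J_inner_X, of v v] v(2)
      by (simp add: dir_deriv_J[OF u] dir_deriv_const)
    moreover have "J u \<bullet> dir_deriv v (X v) u = (X v u \<bullet> X v u) / 2"
      using Q_pos[OF u] by (simp add: J H_inner_dir_deriv_X[OF u])
    ultimately show False using X_eq_0_iff[OF u] v(1) by simp
  qed
  then have "0 < z \<bullet> z" by simp
  also have "z \<bullet> z = r u - 1 / (4 * Q u)"
    using J_inner_H[OF u] Q_pos[OF u]
    by (simp add: z_def inner_diff_left inner_diff_right inner_commute[of "H u" "J u"] field_simps)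
  finally show ?thesis using Q_pos[OF u] by (simp add: field_simps)
qed

lemma dir_deriv_r: assumes u: "u \<in> S" shows "dir_deriv v r u = 2 * \<rho> u * \<theta> v u"
  using dir_deriv_inner[OF open_S u smooth_J smooth_J refl, of v]
  by (simp add: dir_deriv_J[OF u] inner_add_left inner_add_right inner_diff_left inner_diff_right J_inner_X[OF u]
      inner_commute[of "X v u" "J u"] inner_commute[of "M u" "J u"])

lemma smooth_r: "smooth_on S r" and smooth_P: "smooth_on S P" and smooth_rho: "smooth_on S \<rho>"
  by (intro smooth_on_intros open_S smooth_J smooth_N smooth_M)+

text \<open>Regrouped, \<open>P_rho\<close> says that \<open>P\<close> times \<rho> + 2 r^2 equals 2
  Q (1 - 4 Q r). Here \<open>Q\<close>, \<open>r\<close> and \<rho> are already constant to first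
  order along the kernel, and \<open>Qr_gt\<close> makes the right side, hence the factor of
  \<open>P\<close>, nonzero.\<close>

lemma dir_deriv_P_kernel:
  assumes u: "u \<in> S" and v: "\<theta> v u = 0" shows "dir_deriv v P u = 0"
proof -
  have d\<rho>: "dir_deriv v \<rho> u = 0"
    using dir_deriv_inner[OF open_S u smooth_J smooth_M refl, of v]
    by (simp add: dir_deriv_J[OF u] dir_deriv_M[OF u, of v] v inner_commute[of "X v u" "M u"] M_inner_X[OF u])
  have dr: "dir_deriv v r u = 0" by (simp add: dir_deriv_r[OF u] v)
  let ?L = "\<lambda>u. P u * (\<rho> u + 2 * (r u * r u))" and ?R = "\<lambda>u. 2 * Q u * (1 - 4 * (Q u * r u))"
  have eq: "?L p = ?R p" if "p \<in> S" for p
    using P_rho[OF that] by (simp add: power2_eq_square algebra_simps)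
  note hd = smooth_on_has_derivative[OF smooth_P u] smooth_on_has_derivative[OF smooth_rho u]
    smooth_on_has_derivative[OF smooth_r u] smooth_on_has_derivative[OF smooth_Q u]
  have "dir_deriv v ?L u = dir_deriv v P u * (\<rho> u + 2 * (r u * r u))"
    by (rule dir_deriv_eq[THEN trans], rule has_derivative_mult[OF hd(1) has_derivative_add[OF hd(2)
            has_derivative_mult_right[OF has_derivative_mult[OF hd(3) hd(3)]]]]) (simp add: d\<rho> dr)
  moreover have "dir_deriv v ?R u = 0"
    by (rule dir_deriv_eq[THEN trans], rule has_derivative_mult[OF has_derivative_mult_right[OF hd(4)]
          has_derivative_diff[OF has_derivative_const
            has_derivative_mult_right[OF has_derivative_mult[OF hd(4) hd(3)]]]]) (simp add: v dr)
  moreover have "dir_deriv v ?L u = dir_deriv v ?R u" by (rule dir_deriv_cong[OF open_S u eq])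
  moreover have "\<rho> u + 2 * (r u * r u) \<noteq> 0"
    using eq[OF u] Qr_gt[OF u] Q_pos[OF u] by auto
  ultimately show ?thesis by simp
qed

section \<open>The derivative of the gradient field\<close>

abbreviation n :: "real^4 \<Rightarrow> real" where "n \<equiv> \<lambda>u. - (2 * (Q u)\<^sup>2) - r u * P u"

lemmas patch_differentiable = smooth_on_differentiable[OF smooth_Q] smooth_on_differentiable[OF smooth_P]
  smooth_on_differentiable[OF smooth_r] smooth_on_differentiable[OF smooth_mean_curvature]
  smooth_on_differentiable[OF smooth_J] smooth_on_differentiable[OF smooth_M]
  smooth_on_differentiable[OF smooth_N]

lemma smooth_n: "smooth_on S n"
  unfolding power2_eq_square
  by (intro smooth_on_intros open_S smooth_Q smooth_r smooth_P smooth_mean_curvature smooth_J smooth_N)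

text \<open>Differentiate \<open>PM_eq\<close>, solved for \<open>N\<close>, along the kernel: all
  scalars and \<open>M\<close> are constant, while \<open>H\<close> and \<open>J\<close> contribute
  4 Q^2 and - \<delta> times \<open>X v\<close>. Half of the sum is \<open>n\<close>.\<close>

lemma dir_deriv_N_kernel:
  assumes u: "u \<in> S" and v: "\<theta> v u = 0"
  shows "dir_deriv v N u = n u *\<^sub>R X v u"
proof -
  have "2 *\<^sub>R N p = P p *\<^sub>R M p - (4 * Q p) *\<^sub>R H p + \<delta> p *\<^sub>R J p" if "p \<in> S" for p
    unfolding PM_eq[OF that] by simp
  then have "dir_deriv v (\<lambda>p. 2 *\<^sub>R N p) u
      = dir_deriv v (\<lambda>p. P p *\<^sub>R M p - (4 * Q p) *\<^sub>R H p + \<delta> p *\<^sub>R J p) u"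
    by (rule dir_deriv_cong[OF open_S u])
  also have "\<dots> = (4 * (Q u)\<^sup>2 - \<delta> u) *\<^sub>R X v u"
    by (simp add: dir_deriv_simps patch_differentiable u dir_deriv_H[OF u] dir_deriv_J[OF u]
        dir_deriv_M[OF u, of v] dir_deriv_r[OF u] dir_deriv_P_kernel[OF u v] v power2_eq_square)
      (simp flip: scaleR_diff_left scaleR_minus_left scaleR_add_left add: mult.assoc)
  also have "\<dots> = 2 *\<^sub>R (n u *\<^sub>R X v u)"
    by (simp add: algebra_simps)
  finally have "2 *\<^sub>R dir_deriv v N u = 2 *\<^sub>R (n u *\<^sub>R X v u)"
    by (simp add: dir_deriv_simps patch_differentiable u)
  then show ?thesis by (simp only: scaleR_cancel_left) simp
qed

definition N1 :: "real^4 \<Rightarrow> real^6" where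
  "N1 u = (1 / \<theta> v0 u) *\<^sub>R (dir_deriv v0 N u - n u *\<^sub>R X v0 u)"

lemma smooth_N1: "smooth_on S N1"
  unfolding N1_def[abs_def]
  by (intro smooth_on_scaleR smooth_on_diff smooth_on_dir_deriv smooth_theta_inverse smooth_n open_S
      smooth_N smooth_x)

lemma dir_deriv_N: assumes u: "u \<in> S" shows "dir_deriv v N u = n u *\<^sub>R X v u + \<theta> v u *\<^sub>R N1 u"
proof -
  have lin: "linear (\<lambda>v. dir_deriv v N u - n u *\<^sub>R X v u)"
    by (intro linear_compose_sub linear_compose_scale_right linear_X[OF u] linear_dir_deriv_on[OF smooth_N u])
  show ?thesis
    using linear_combination_theta[OF u lin, of v] dir_deriv_N_kernel[OF u]
    by (simp add: N1_def diff_eq_eq)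
qed

text \<open>The Hessian of \<open>Q\<close> is the tangential part of the derivative of
  \<open>N\<close>. Comparing its trace with the value in \<open>laplacian_Q\<close> determines
  \<open>N \<bullet> N1\<close>, and thereby dP/dQ.\<close>

lemma laplacian_Q_eq: assumes u: "u \<in> S" shows "laplacian x Q u = 4 * n u + N u \<bullet> N1 u"
proof -
  obtain w where w: "N u = X w u" using gradient_tangent[OF u, of Q] by blast
  have ND: "N u \<bullet> dir_deriv (axis i 1) (X (axis j 1)) u
      = (\<Sum>k\<in>UNIV. christoffel x u k i j * \<theta> (axis k 1) u)" for i j
  proof -
    have "N u \<bullet> B u (axis i 1) (axis j 1) = 0"
      using B_inner_X[OF u] by (simp add: w inner_commute)
    then show ?thesis
      by (simp add: dir_deriv_X_eq[OF u] inner_add_right inner_sum_right N_inner_X[OF u])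
  qed
  have "dir_deriv (axis i 1) (\<theta> (axis j 1)) u - (\<Sum>k\<in>UNIV. christoffel x u k i j * \<theta> (axis k 1) u)
      = dir_deriv (axis i 1) N u \<bullet> X (axis j 1) u" for i j
    using dir_deriv_inner[OF open_S u smooth_N smooth_X N_inner_X, of "axis i 1" "axis j 1"]
    by (simp add: ND)
  then have "laplacian x Q u = metric_trace x u (\<lambda>v w. dir_deriv v N u \<bullet> X w u)"
    by (simp add: laplacian_def metric_trace_def partial_eq_dir_deriv)
  also have "\<dots> = metric_trace x u (\<lambda>v w. n u *\<^sub>R (X v u \<bullet> X w u) + (\<theta> v u *\<^sub>R X w u) \<bullet> N1 u)"
    by (rule metric_trace_cong) (simp add: dir_deriv_N[OF u] inner_add_left inner_commute[of "N1 u"])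
  also have "\<dots> = n u * 4 + N u \<bullet> N1 u"
    unfolding metric_trace_add metric_trace_scaleR metric_trace_metric[OF u] metric_trace_inner_left
    by (simp add: gradient_def)
  finally show ?thesis by simp
qed

lemma N_inner_N1: "u \<in> S \<Longrightarrow> N u \<bullet> N1 u = 16 * (Q u)\<^sup>2 + 6 * (r u * P u)"
  using laplacian_Q_eq[of u] laplacian_Q[of u] by simp

lemma dir_deriv_P: assumes u: "u \<in> S" shows "dir_deriv v P u = \<theta> v u * (28 * (Q u)\<^sup>2 + 10 * (r u * P u))"
proof -
  have "dir_deriv v P u = 2 * (\<theta> v u * n u) + 2 * (\<theta> v u * (N u \<bullet> N1 u))"
    using dir_deriv_inner[OF open_S u smooth_N smooth_N refl, of v]
    by (simp add: dir_deriv_N[OF u] inner_add_left inner_add_right N_inner_X[OF u]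
        inner_commute[of "X v u" "N u"] inner_commute[of "N1 u" "N u"] algebra_simps)
  then show ?thesis unfolding N_inner_N1[OF u] by (simp add: algebra_simps)
qed

text \<open>The coefficient is dn/dQ, computed from dP/dQ and dr/dQ = 2 \<rho>, with \<rho>
  eliminated by \<open>P_rho\<close>; \<open>derivative_step\<close> passes it from \<open>N\<close>
  to \<open>N1\<close>.\<close>

lemma dir_deriv_N1_kernel:
  assumes u: "u \<in> S" and v: "\<theta> v u = 0"
  shows "dir_deriv v N1 u = - (8 * Q u + 12 * (Q u)\<^sup>2 * r u + 6 * (r u)\<^sup>2 * P u) *\<^sub>R X v u"
proof -
  have "dir_deriv w n u = - (4 * Q u + 2 * (P u * \<rho> u) + r u * (28 * (Q u)\<^sup>2 + 10 * (r u * P u))) * \<theta> w u"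
    for w
    by (simp add: dir_deriv_simps patch_differentiable u dir_deriv_r[OF u] dir_deriv_P[OF u])
      (simp add: algebra_simps power2_eq_square)
  also have "(4 * Q u + 2 * (P u * \<rho> u) + r u * (28 * (Q u)\<^sup>2 + 10 * (r u * P u)))
      = 8 * Q u + 12 * (Q u)\<^sup>2 * r u + 6 * (r u)\<^sup>2 * P u"
    unfolding P_rho[OF u] by (simp add: algebra_simps power2_eq_square)
  finally have "dir_deriv w n u
      = - (8 * Q u + 12 * (Q u)\<^sup>2 * r u + 6 * (r u)\<^sup>2 * P u) * \<theta> w u" for w .
  from derivative_step[OF smooth_N smooth_N1 smooth_n dir_deriv_N u this, of v] show ?thesis
    by (simp only: v) simp
qed

lemma N1_inner_H: assumes u: "u \<in> S" shows "N1 u \<bullet> H u = Q u"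
proof -
  have "dir_deriv v0 N u \<bullet> H u + N u \<bullet> dir_deriv v0 H u = 0"
    using dir_deriv_inner[OF open_S u smooth_N smooth_mean_curvature, of "\<lambda>_. 0" v0]
    by (simp add: dir_deriv_const inner_commute[of "N _"] H_inner_N)
  then have "\<theta> v0 u * (N1 u \<bullet> H u - Q u) = 0"
    using J_inner_N[OF u] by (simp add: dir_deriv_N[OF u] dir_deriv_H[OF u] inner_add_left inner_add_right
        inner_commute[of "X v0 u" "H u"] mean_curvature_inner_X[OF u] N_inner_X[OF u]
        inner_commute[of "N u" "J u"] algebra_simps)
  then show ?thesis using dQ_nonzero[OF u] by simp
qed

lemma N_inner_M: assumes u: "u \<in> S" shows "N u \<bullet> M u = 2"
proof -
  have "P u * (N u \<bullet> M u) = 2 * P u"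
    using arg_cong[OF PM_eq[OF u], of "\<lambda>y. y \<bullet> N u"]
    by (simp add: inner_add_left inner_diff_left H_inner_N[OF u] J_inner_N[OF u]
        inner_commute[of "N u" "M u"])
  then show ?thesis using P_pos[OF u] by simp
qed

lemma N1_inner_J: assumes u: "u \<in> S" shows "N1 u \<bullet> J u = - 1"
proof -
  have "dir_deriv v0 N u \<bullet> J u + N u \<bullet> dir_deriv v0 J u = 0"
    using dir_deriv_inner[OF open_S u smooth_N smooth_J, of "\<lambda>_. 0" v0]
    by (simp add: dir_deriv_const inner_commute[of "N _"] J_inner_N)
  then have "\<theta> v0 u * (N1 u \<bullet> J u + 1) = 0"
    by (simp add: dir_deriv_N[OF u] dir_deriv_J[OF u] inner_add_left inner_add_right inner_diff_right
        inner_commute[of "X v0 u" "J u"] J_inner_X[OF u] N_inner_X[OF u] N_inner_M[OF u] algebra_simps)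
  then show ?thesis using dQ_nonzero[OF u] by simp
qed

text \<open>Symmetry of the Hessian of \<open>Q\<close> makes the tangential part of
  \<open>N1\<close> a multiple of \<open>N\<close>, and \<open>N_inner_N1\<close> gives the
  factor.\<close>

lemma N1_inner_X:
  assumes u: "u \<in> S" shows "P u * (N1 u \<bullet> X v u) = (16 * (Q u)\<^sup>2 + 6 * (r u * P u)) * \<theta> v u"
proof -
  have D: "dir_deriv a (\<theta> b) u = n u * (X a u \<bullet> X b u) + \<theta> a u * (N1 u \<bullet> X b u) + N u \<bullet> dir_deriv a (X b) u"
    for a b
    using dir_deriv_inner[OF open_S u smooth_N smooth_X N_inner_X, of a b]
    by (simp add: dir_deriv_N[OF u] inner_add_left)
  have sym: "\<theta> a u * (N1 u \<bullet> X b u) = \<theta> b u * (N1 u \<bullet> X a u)" for a b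
    using D[of a b] D[of b a] X_commute[OF u, of a b] dir_deriv_commute[OF open_S u smooth_Q, of a b]
    by (simp add: inner_commute[of "X b u" "X a u"])
  obtain w where w: "N u = X w u" using gradient_tangent[OF u, of Q] by blast
  have "\<theta> w u = P u" using N_inner_X[OF u, of w] w by simp
  then show ?thesis
    using sym[of w v] N_inner_N1[OF u] w by (simp add: inner_commute[of "N1 u"])
qed

section \<open>The polynomial relation and its derivative\<close>

lemma eq_0_if_orthogonal:
  assumes u: "u \<in> S" and y: "\<And>v. y \<bullet> X v u = 0" "y \<bullet> H u = 0" "y \<bullet> J u = 0"
  shows "y = 0"
proof -
  obtain \<eta> where \<eta>: "\<eta> \<bullet> \<eta> = 1" "\<eta> \<bullet> H u = 0" "\<And>v. \<eta> \<bullet> X v u = 0"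
    "\<And>y. (\<And>v. y \<bullet> X v u = 0) \<Longrightarrow> y \<bullet> H u = 0 \<Longrightarrow> y = (y \<bullet> \<eta>) *\<^sub>R \<eta>"
    using normal_line[OF u _ H_nonzero[OF u]] by auto
  define z where "z = J u - (1 / (2 * Q u)) *\<^sub>R H u"
  have z: "z = (z \<bullet> \<eta>) *\<^sub>R \<eta>"
    by (rule \<eta>(4)) (use Q_pos[OF u] in \<open>simp_all add: z_def inner_diff_left J_inner_X[OF u]
        mean_curvature_inner_X[OF u] J_inner_H[OF u]\<close>)
  have "z \<bullet> z = r u - 1 / (4 * Q u)"
    using J_inner_H[OF u] Q_pos[OF u]
    by (simp add: z_def inner_diff_left inner_diff_right inner_commute[of "H u" "J u"] field_simps)
  then have "z \<noteq> 0" using Qr_gt[OF u] Q_pos[OF u] by (auto simp: field_simps)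
  then have "z \<bullet> \<eta> \<noteq> 0" using z by auto
  moreover have "y \<bullet> z = (z \<bullet> \<eta>) * (y \<bullet> \<eta>)" by (metis inner_scaleR_right z)
  moreover have "y \<bullet> z = 0" by (simp add: z_def inner_diff_right y)
  ultimately have "y \<bullet> \<eta> = 0" by simp
  then show ?thesis using \<eta>(4)[OF y(1,2)] by simp
qed

text \<open>The normal coefficients solve the Gram system of \<open>H\<close> and \<open>J\<close>,
  with matrix rows (Q, 1/2) and (1/2, r) and right side (Q, -1). Its determinant is (4 Q r - 1) / 4,
  and denominators are cleared.\<close>

lemma N1_decomposition:
  assumes u: "u \<in> S"
  shows "((4 * Q u * r u - 1) * P u) *\<^sub>R N1 u
    = ((16 * (Q u)\<^sup>2 + 6 * (r u * P u)) * (4 * Q u * r u - 1)) *\<^sub>R N u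
      + (P u * (4 * Q u * r u + 2)) *\<^sub>R H u - (6 * Q u * P u) *\<^sub>R J u" (is "?l = ?r")
proof -
  have "?l - ?r = 0"
  proof (rule eq_0_if_orthogonal[OF u])
    fix v
    show "(?l - ?r) \<bullet> X v u = 0"
      using N1_inner_X[OF u, of v]
      by (simp add: inner_add_left inner_diff_left J_inner_X[OF u] mean_curvature_inner_X[OF u] N_inner_X[OF u]
          mult.assoc)
    show "(?l - ?r) \<bullet> H u = 0"
      using H_inner_N[OF u] by (simp add: inner_add_left inner_diff_left J_inner_H[OF u] N1_inner_H[OF u]
          inner_commute[of "N u" "H u"] algebra_simps)
    show "(?l - ?r) \<bullet> J u = 0"
      by (simp add: inner_add_left inner_diff_left N1_inner_J[OF u] J_inner_N[OF u] J_inner_H[OF u] inner_commute[of "H u" "J u"]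
          inner_commute[of "N u" "J u"] algebra_simps)
  qed
  then show ?thesis by simp
qed

text \<open>Along the kernel of \<open>dQ\<close> all scalar coefficients are constant and
  \<open>N1\<close>, \<open>N\<close>, \<open>H\<close>, \<open>J\<close> change only by multiples
  of \<open>X v\<close>. Differentiating \<open>N1_decomposition\<close> therefore compares two
  coefficients of the nonzero vector \<open>X v u\<close>.\<close>

lemma scalar_equation:
  assumes u: "u \<in> S"
  shows "(4 * Q u * r u - 1) * (8 * (Q u) ^ 3 - 2 * P u + 4 * Q u * r u * P u) + P u * (Q u * r u - 1) = 0"
proof -
  obtain v where v: "v \<noteq> 0" "\<theta> v u = 0" using kernel_theta_nontrivial[OF u] .
  let ?L = "\<lambda>u. ((4 * Q u * r u - 1) * P u) *\<^sub>R N1 u"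
  let ?R = "\<lambda>u. ((16 * (Q u)\<^sup>2 + 6 * (r u * P u)) * (4 * Q u * r u - 1)) *\<^sub>R N u
      + (P u * (4 * Q u * r u + 2)) *\<^sub>R H u - (6 * Q u * P u) *\<^sub>R J u"
  let ?c = "(4 * Q u * r u - 1) * P u * - (8 * Q u + 12 * (Q u)\<^sup>2 * r u + 6 * (r u)\<^sup>2 * P u)"
  let ?d = "(16 * (Q u)\<^sup>2 + 6 * (r u * P u)) * (4 * Q u * r u - 1) * n u
      - P u * (4 * Q u * r u + 2) * Q u + 6 * Q u * P u"
  have "dir_deriv v ?L u = ?c *\<^sub>R X v u"
    by (simp add: dir_deriv_simps patch_differentiable smooth_on_differentiable[OF smooth_N1] u
        dir_deriv_N1_kernel[OF u v(2)] dir_deriv_r[OF u] dir_deriv_P[OF u] v(2))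
  moreover have "dir_deriv v ?R u = ?d *\<^sub>R X v u"
    by (simp add: dir_deriv_simps patch_differentiable u dir_deriv_N_kernel[OF u v(2)]
        dir_deriv_H[OF u] dir_deriv_J[OF u] dir_deriv_r[OF u] dir_deriv_P[OF u] v(2))
      (simp add: scaleR_add_left scaleR_diff_left)
  moreover have "dir_deriv v ?L u = dir_deriv v ?R u"
    by (rule dir_deriv_cong[OF open_S u N1_decomposition])
  ultimately have "?c = ?d" using X_eq_0_iff[OF u] v(1) by simp
  \<comment> \<open>The terms with r^2 P^2 cancel, which leaves the common factor 4 Q.\<close>
  then have "4 * Q u * ((4 * Q u * r u - 1) * (8 * (Q u) ^ 3 - 2 * P u + 4 * Q u * r u * P u) + P u * (Q u * r u - 1)) = 0"
    by algebra
  then show ?thesis using Q_pos[OF u] by simp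
qed

lemma scalar_equation_derivative:
  assumes u: "u \<in> S"
  shows "(4 * r u + 8 * Q u * \<rho> u) * (8 * (Q u) ^ 3 - 2 * P u + 4 * Q u * r u * P u)
    + (4 * Q u * r u - 1) * (24 * (Q u)\<^sup>2 - 2 * (28 * (Q u)\<^sup>2 + 10 * (r u * P u)) + 4 * r u * P u
      + 8 * Q u * \<rho> u * P u + 4 * Q u * r u * (28 * (Q u)\<^sup>2 + 10 * (r u * P u)))
    + (28 * (Q u)\<^sup>2 + 10 * (r u * P u)) * (Q u * r u - 1) + P u * (r u + 2 * Q u * \<rho> u) = 0" (is "?D = 0")
proof -
  let ?f = "\<lambda>u. (4 * Q u * r u - 1) * (8 * (Q u) ^ 3 - 2 * P u + 4 * Q u * r u * P u) + P u * (Q u * r u - 1)"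
  have "dir_deriv v0 ?f u = \<theta> v0 u * ?D"
    by (simp add: dir_deriv_simps patch_differentiable u dir_deriv_r[OF u] dir_deriv_P[OF u])
      (simp add: algebra_simps)
  moreover have "dir_deriv v0 ?f u = 0"
    using dir_deriv_cong[OF open_S u scalar_equation, where v = v0] by (simp only: dir_deriv_const)
  ultimately show ?thesis using dQ_nonzero[OF u] by simp
qed

end

section \<open>Elimination of the scalar unknowns\<close>

lemma scalar_equations_contradictory:
  fixes Q P r \<rho> :: real
  assumes Q: "0 < Q" and P: "0 < P" and y: "1 < 4 * Q * r"
    and \<rho>: "P * \<rho> = 2 * Q - 8 * Q\<^sup>2 * r - 2 * r\<^sup>2 * P"
    and E: "(4 * Q * r - 1) * (8 * Q ^ 3 - 2 * P + 4 * Q * r * P) + P * (Q * r - 1) = 0"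
    and D: "(4 * r + 8 * Q * \<rho>) * (8 * Q ^ 3 - 2 * P + 4 * Q * r * P)
      + (4 * Q * r - 1) * (24 * Q\<^sup>2 - 2 * (28 * Q\<^sup>2 + 10 * (r * P)) + 4 * r * P
        + 8 * Q * \<rho> * P + 4 * Q * r * (28 * Q\<^sup>2 + 10 * (r * P)))
      + (28 * Q\<^sup>2 + 10 * (r * P)) * (Q * r - 1) + P * (r + 2 * Q * \<rho>) = 0"
  shows False
proof -
  \<comment> \<open>A homothety by a factor t scales \<open>Q\<close>, \<open>P\<close>,
    \<open>r\<close>, \<rho> by t^-2, t^-6, t^2, t^4. Hence \<open>z\<close>, \<open>k\<close> and
    Q^2 \<rho> are scale invariant, and by \<open>\<rho>\<close> the last is a polynomial in the
    other two.\<close>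
  define z k where "z = Q ^ 3 / P" and "k = 4 * Q * r - 1"
  have z: "0 < z" and k: "0 < k" using Q P y by (simp_all add: z_def k_def)
  have Q3: "Q ^ 3 = z * P" using P by (simp add: z_def)
  have r: "Q * r = (1 + k) / 4" by (simp add: k_def)
  have \<rho>': "Q\<^sup>2 * \<rho> = - 2 * z * k - 2 * ((1 + k) / 4)\<^sup>2"
  proof -
    have "P * (Q\<^sup>2 * \<rho>) = Q\<^sup>2 * (2 * Q - 8 * Q\<^sup>2 * r - 2 * r\<^sup>2 * P)"
      unfolding \<rho>[symmetric] by simp
    also have "\<dots> = 2 * Q ^ 3 * (1 - 4 * (Q * r)) - 2 * (Q * r)\<^sup>2 * P"
      by (simp add: algebra_simps power2_eq_square power3_eq_cube)
    also have "\<dots> = P * (- 2 * z * k - 2 * ((1 + k) / 4)\<^sup>2)"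
      unfolding Q3 r by (simp add: algebra_simps)
    finally show ?thesis using P by simp
  qed
  have "P * (32 * z * k + 4 * k\<^sup>2 - 3 * k - 3) = 0"
    using E unfolding Q3 mult.assoc[of 4 Q] r by (simp add: field_simps power2_eq_square)
  then have F: "32 * z * k + 4 * k\<^sup>2 - 3 * k - 3 = 0" using P by simp
  let ?w = "Q\<^sup>2 * \<rho>" and ?y = "Q * r"
  \<comment> \<open>Multiplying \<open>D\<close> by \<open>Q\<close> gives it the same weight as
    \<open>P\<close>, which then factors out.\<close>
  have "P * ((4 * ?y + 8 * ?w) * (8 * z - 2 + 4 * ?y)
      + (4 * ?y - 1) * (24 * z - 2 * (28 * z + 10 * ?y) + 4 * ?y + 8 * ?w + 4 * ?y * (28 * z + 10 * ?y))
      + (28 * z + 10 * ?y) * (?y - 1) + ?y + 2 * ?w) = Q * 0"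
    unfolding D[symmetric] using Q3 by algebra
  then have "(4 * ?y + 8 * ?w) * (8 * z - 2 + 4 * ?y)
      + (4 * ?y - 1) * (24 * z - 2 * (28 * z + 10 * ?y) + 4 * ?y + 8 * ?w + 4 * ?y * (28 * z + 10 * ?y))
      + (28 * z + 10 * ?y) * (?y - 1) + ?y + 2 * ?w = 0" (is "?E = 0")
    using P by simp
  \<comment> \<open>\<open>4 * ?E\<close> is, up to a multiple of the left side of \<open>F\<close>, the derivative of that side under $Q\,d/dQ$, by
    $Q k' = -k(1+k+16z)$ and $Q z' = z(1/2 - 28z - 5k/2)$.\<close>
  moreover have "4 * ?E = k * (- 1408 * z\<^sup>2 - 240 * k * z + 32 * z - 8 * k\<^sup>2 - 5 * k + 3)
      + (28 * z + 5 * (1 + k) / 2) * (32 * z * k + 4 * k\<^sup>2 - 3 * k - 3)"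
    unfolding r \<rho>' by (simp add: field_simps power2_eq_square)
  ultimately have G: "- 1408 * z\<^sup>2 - 240 * k * z + 32 * z - 8 * k\<^sup>2 - 5 * k + 3 = 0"
    using F k by simp
  have "0 < z * k" using z k by simp
  \<comment> \<open>The value 1/88 completes the square in 1408 z^2 - 32 z, which is thus at least
    -2/11. Then \<open>G\<close> plus twice \<open>F\<close> bounds 0 above by - 176 z k - 11 k -
    31/11, a negative number.\<close>
  moreover have "0 \<le> (z - 1 / 88)\<^sup>2" by simp
  then have "0 \<le> z\<^sup>2 - z / 44 + 1 / 7744" by (simp add: power2_eq_square algebra_simps)
  ultimately show False using F G k by (simp add: mult.commute)
qed

section \<open>From patches to the manifold\<close>

lemma minimal_patch:
  fixes x :: "real^4 \<Rightarrow> real^6"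
  assumes patch: "pseudo_umbilical_biharmonic_patch x S" and u: "u \<in> S"
  shows "mean_curvature x u = 0"
proof (rule ccontr)
  assume H: "mean_curvature x u \<noteq> 0"
  interpret pseudo_umbilical_biharmonic_patch x S by (rule patch)
  define W where "W = S \<inter> Q -` (- {0})"
  have W: "open W" "W \<subseteq> S"
    unfolding W_def
    by (auto intro!: continuous_open_preimage smooth_on_continuous_on[OF smooth_Q] open_S)
  have "u \<in> W" using u H by (simp add: W_def)
  \<comment> \<open>Were \<open>dQ\<close> zero on all of \<open>W\<close>, then \<open>H u\<close>
    would vanish. The contradiction is derived at \<open>p\<close>, which may differ from
    \<open>u\<close>.\<close>
  then obtain p v0 where p: "p \<in> W" "\<theta> v0 p \<noteq> 0"
    using mean_curvature_eq_0_if_dQ_eq_0[OF W] H by blast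
  define T where "T = S \<inter> \<theta> v0 -` (- {0})"
  have T: "open T" "T \<subseteq> S" "p \<in> T"
    unfolding T_def using p W(2)
    by (auto intro!: continuous_open_preimage
        smooth_on_continuous_on[OF smooth_on_dir_deriv[OF smooth_Q]] open_S)
  interpret V: varying_curvature_patch x T v0
  proof unfold_locales
    show "open T" by (rule T)
    show "smooth_on T x" by (rule smooth_on_subset[OF smooth_x T(2)])
  next
    fix q assume q: "q \<in> T"
    then have "q \<in> S" using T by auto
    then show "inj (frechet_derivative x (at q))" "laplacian x (mean_curvature x) q = 0"
      "\<And>v. shape_operator x q (mean_curvature x q) v = (norm (mean_curvature x q))\<^sup>2 *\<^sub>R v"
      using inj_x biharmonic umbilical by blast+
    show "dir_deriv v0 (\<lambda>u. mean_curvature x u \<bullet> mean_curvature x u) q \<noteq> 0"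
      using q by (simp add: T_def)
  qed
  show False
    by (rule scalar_equations_contradictory[OF V.Q_pos[OF T(3)] V.P_pos[OF T(3)] V.Qr_gt[OF T(3)]
        V.P_rho[OF T(3)] V.scalar_equation[OF T(3)] V.scalar_equation_derivative[OF T(3)]])
qed

theorem corollary1p4:
  fixes X :: "'a topology"
    and \<A> :: "('a, 4) chart set"
    and f :: "'a \<Rightarrow> real^6"
  assumes "immersed_submanifold X \<A> f"
    and "pseudo_umbilical \<A> f"
    and "biharmonic_submanifold \<A> f"
  shows "minimal_submanifold \<A> f"
  unfolding minimal_submanifold_def
proof (intro ballI)
  fix c u assume c: "c \<in> \<A>" and u: "u \<in> chart_image c"
  have "smooth_atlas X \<A>" "smooth_immersion \<A> f"
    using assms(1) by (auto simp: immersed_submanifold_def smooth_manifold_def)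
  with c have "immersed_patch (local_rep f c) (chart_image c)"
    by (auto simp: immersed_patch_def smooth_atlas_def smooth_immersion_def)
  then have "pseudo_umbilical_biharmonic_patch (local_rep f c) (chart_image c)"
    using assms(2,3) c
    unfolding pseudo_umbilical_biharmonic_patch_def pseudo_umbilical_biharmonic_patch_axioms_def
      pseudo_umbilical_def biharmonic_submanifold_def
    by blast
  then show "mean_curvature (local_rep f c) u = 0" using u by (rule minimal_patch)
qed

end
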